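(* Let $c>0$ and let $\Omega\subset\mathbb{R}^3$ be a bounded convex open region. For $i=1,2$ let $$f_i(x,t)=\lambda^{(i)}(t)\sum_{j=1}^{M_i}a_j^{(i)}\,\delta\bigl(x-s_j^{(i)}\bigr)$$ be two source terms, where $M_i$ is a positive integer, $s_1^{(i)},\dots,s_{M_i}^{(i)}\in\Omega$ are mutually distinct points (for each fixed $i$), $a_j^{(i)}>0$, and $\lambda^{(i)}\in C(\mathbb{R})$. Let $u_1$ and $u_2$ be the corresponding causal solutions of $$c^{-2}\partial_{tt}u_i(x,t)-\Delta u_i(x,t)=f_i(x,t),\qquad x\in\mathbb{R}^3,\ t\in\mathbb{R},\quad i=1,2.$$ Assume that $\lambda^{(1)}$ and $\lambda^{(2)}$ are nontrivial (not identically zero) causal functions and that $$u_1=u_2\quad\text{on }\partial\Omega\times\mathbb{R}.$$ Then $M_1=M_2=:M$, and there is a permutation $\pi$ of $\{1,2,\dots,M\}$ such that for every $j=1,\dots,M$, $$s_j^{(1)}=s_{\pi(j)}^{(2)}\quad\text{and}\quad a_j^{(1)}\lambda^{(1)}(t)=a_{\pi(j)}^{(2)}\lambda^{(2)}(t)\ \text{ for all } t\in\mathbb{R}.$$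
   Context: A function $\lambda:\mathbb{R}\to\mathbb{R}$ is called causal if $\lambda(t)=0$ for all $t<0$. $\delta$ is the Dirac delta distribution, $\Delta$ is the Laplacian in $x\in\mathbb{R}^3$, and $c>0$ is the constant sound speed. Solutions of the wave equation are understood to be causal, i.e. to vanish for $t<0$, with $u(\cdot,0)=\partial_t u(\cdot,0)=0$ in $\mathbb{R}^3$. The unique causal solution for the source $\lambda(t)\sum_{j=1}^{M}a_j\delta(x-s_j)$ is $$u(x,t)=\sum_{j=1}^{M}a_j\,\frac{\lambda\bigl(t-c^{-1}|x-s_j|\bigr)}{4\pi|x-s_j|},$$ where $|\cdot|$ is the Euclidean norm. *)

theory Defs
  imports "HOL-Analysis.Analysis" "HOL-Combinatorics.Permutations"
begin

text \<open>
  The wave equation is read in the sense of distributions on space-time, whose points are pairs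
  \<open>(x, t)\<close>. A distribution is represented by its action on test functions.
\<close>

type_synonym spacetime = "(real^3) \<times> real"
type_synonym distr = "(spacetime \<Rightarrow> real) \<Rightarrow> real"

definition dir_deriv :: "'a::real_normed_vector \<Rightarrow> ('a \<Rightarrow> real) \<Rightarrow> 'a \<Rightarrow> real" where
  "dir_deriv v f z = frechet_derivative f (at z) v"

primrec Ck :: "nat \<Rightarrow> ('a::real_normed_vector \<Rightarrow> real) \<Rightarrow> bool" where
  "Ck 0 f \<longleftrightarrow> continuous_on UNIV f"
| "Ck (Suc k) f \<longleftrightarrow> (\<forall>z. f differentiable (at z)) \<and> (\<forall>v. Ck k (dir_deriv v f))"

definition smooth :: "('a::real_normed_vector \<Rightarrow> real) \<Rightarrow> bool" where
  "smooth f \<longleftrightarrow> (\<forall>k. Ck k f)"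

definition test_function :: "(spacetime \<Rightarrow> real) \<Rightarrow> bool" where
  "test_function \<phi> \<longleftrightarrow> smooth \<phi> \<and> compact (closure {z. \<phi> z \<noteq> 0})"

definition distr_deriv :: "spacetime \<Rightarrow> distr \<Rightarrow> distr" where
  "distr_deriv v T \<phi> = - T (dir_deriv v \<phi>)"

definition distr_of :: "(real^3 \<Rightarrow> real \<Rightarrow> real) \<Rightarrow> distr" where
  "distr_of u \<phi> = (LINT (x, t)|lebesgue. u x t * \<phi> (x, t))"

definition wave_op :: "real \<Rightarrow> distr \<Rightarrow> distr" where
  "wave_op c T \<phi> =
     (1 / c\<^sup>2) * distr_deriv (0, 1) (distr_deriv (0, 1) T) \<phi>
     - (\<Sum>b\<in>Basis. distr_deriv (b, 0) (distr_deriv (b, 0) T) \<phi>)"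

definition dirac :: "real^3 \<Rightarrow> (real^3 \<Rightarrow> real) \<Rightarrow> real" where
  "dirac s g = g s"

text \<open>The source \<open>\<lambda>(t) \<Sum>\<^sub>j a\<^sub>j \<delta>(x - s\<^sub>j)\<close>, with \<open>j\<close> ranging over \<open>1, \<dots>, M\<close>.\<close>

definition point_sources ::
  "(real \<Rightarrow> real) \<Rightarrow> nat \<Rightarrow> (nat \<Rightarrow> real) \<Rightarrow> (nat \<Rightarrow> real^3) \<Rightarrow> distr" where
  "point_sources lam M a s \<phi> =
     (LINT t|lebesgue. lam t * (\<Sum>j=1..M. a j * dirac (s j) (\<lambda>x. \<phi> (x, t))))"

definition causal :: "(real \<Rightarrow> real) \<Rightarrow> bool" where
  "causal lam \<longleftrightarrow> (\<forall>t<0. lam t = 0)"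

text \<open>
  A solution is singular at the source points (like \<open>1 / \<bar>x - s\<^sub>j\<bar>\<close>), so its pointwise values are
  meaningful only away from the set \<open>S\<close> of these points; there \<open>u\<close> is required to be the
  continuous representative, so that it can be restricted to surfaces avoiding \<open>S\<close>.
\<close>

definition causal_wave_solution ::
  "real \<Rightarrow> distr \<Rightarrow> (real^3) set \<Rightarrow> (real^3 \<Rightarrow> real \<Rightarrow> real) \<Rightarrow> bool" where
  "causal_wave_solution c F S u \<longleftrightarrow>
     continuous_on ((- S) \<times> UNIV) (\<lambda>(x, t). u x t) \<and>
     (\<forall>K. compact K \<longrightarrow> (\<lambda>(x, t). u x t) absolutely_integrable_on K) \<and>
     (\<forall>\<phi>. test_function \<phi> \<longrightarrow> wave_op c (distr_of u) \<phi> = F \<phi>) \<and>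
     (\<forall>x. x \<notin> S \<longrightarrow> causal (u x)) \<and>
     (\<forall>x. x \<notin> S \<longrightarrow> u x 0 = 0 \<and> (u x has_real_derivative 0) (at 0))"

end

theory Submission
  imports Defs
begin

text \<open>
  Testing the wave equation against a backward spherical wave \<open>h (c t + \<bar>x - x0\<bar>) / \<bar>x - x0\<bar>\<close>, cut off
  near its centre at scale \<open>\<epsilon>\<close>, and letting \<open>\<epsilon>\<close> tend to 0 shows that two solutions which agree at a
  point \<open>x0\<close> away from the sources have the same retarded potential there; neither the uniqueness nor
  the representation of the solution is needed. Grouping the sources by location, it remains to see
  that a finite superposition of causal spherical waves centred in \<open>\<Omega>\<close> and vanishing on the boundary
  is trivial. Otherwise some boundary point is reached by one of the waves strictly before all others,
  and there this wave is not cancelled.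
\<close>

subsection \<open>Smooth functions\<close>

text \<open>The equation holds only weakly, while a comparison at the single point \<open>x0\<close>
  is wanted, so the value there has to be extracted by test functions. A function of
  \<open>c t + r\<close> divided by r solves the homogeneous equation off its centre; cutting it off
  with \<open>g\<close> therefore leaves only \<open>- (g'' h + 2 g' h') / r\<close>, which lives
  where \<open>g\<close> is not constant. With \<open>h\<close> of width \<epsilon> and
  \<open>g\<close> switching on between \<epsilon> and 2\<epsilon>, the inner part has size
  \<epsilon>^-3 on a space-time ball of volume of order \<epsilon>^4. It thus contributes \<epsilon>
  times the size of \<open>u1 - u2\<close> on that ball, and the sources contribute \<epsilon>/c
  times an average of the retarded potentials. The powers match, so mere continuity of
  \<open>u1 - u2\<close> at \<open>(x0, t0)\<close> decides, without any rate. The norm is not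
  smooth at the centre. Hence regularity is developed relative to open sets, and the test wave is
  glued from the region off the axis x = x0 and a tube around the axis where it is 0.\<close>

primrec Ck_on :: "nat \<Rightarrow> 'a::real_normed_vector set \<Rightarrow> ('a \<Rightarrow> real) \<Rightarrow> bool" where
  "Ck_on 0 U f \<longleftrightarrow> continuous_on U f"
| "Ck_on (Suc k) U f \<longleftrightarrow> (\<forall>z\<in>U. f differentiable (at z)) \<and> (\<forall>v. Ck_on k U (dir_deriv v f))"

lemma Ck_on_UNIV: "Ck_on k UNIV f = Ck k f"
  by (induction k arbitrary: f) auto

lemma dir_deriv_eq: "(f has_derivative f') (at z) \<Longrightarrow> dir_deriv v f z = f' v"
  by (simp add: dir_deriv_def frechet_derivative_at[symmetric])

lemma has_derivative_dir_deriv: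
  "f differentiable (at z) \<Longrightarrow> (f has_derivative (\<lambda>v. dir_deriv v f z)) (at z)"
  unfolding dir_deriv_def by (simp add: frechet_derivative_works eta_contract_eq)

lemma dir_deriv_cong:
  assumes "open U" "\<And>z. z \<in> U \<Longrightarrow> f z = g z" "f differentiable (at z)" "z \<in> U"
  shows "dir_deriv v f z = dir_deriv v g z"
  unfolding dir_deriv_def
  using frechet_derivative_transform_within_open[OF assms(3,1,4,2)] by simp

lemma differentiable_cong_open:
  assumes "open U" "\<And>z. z \<in> U \<Longrightarrow> f z = g z" "f differentiable (at z)" "z \<in> U"
  shows "g differentiable (at z)"
  using assms by (meson differentiable_def has_derivative_transform_within_open)

lemma Ck_on_cong:
  assumes "open U" "Ck_on k U f" "\<And>z. z \<in> U \<Longrightarrow> f z = g z"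
  shows "Ck_on k U g"
  using assms(2,3)
proof (induction k arbitrary: f g)
  case 0
  then show ?case by (simp cong: continuous_on_cong)
next
  case (Suc k)
  have d: "f differentiable (at z)" if "z \<in> U" for z using Suc.prems that by auto
  show ?case
  proof (simp, intro conjI ballI allI)
    show "g differentiable (at z)" if "z \<in> U" for z
      using differentiable_cong_open[OF assms(1) Suc.prems(2) d[OF that] that] by simp
    show "Ck_on k U (dir_deriv v g)" for v
    proof (rule Suc.IH)
      show "Ck_on k U (dir_deriv v f)" using Suc.prems by auto
      show "dir_deriv v f z = dir_deriv v g z" if "z \<in> U" for z
        using dir_deriv_cong[OF assms(1) Suc.prems(2) d[OF that] that] by simp
    qed
  qed
qed

lemma Ck_on_union:
  assumes "open U" "open V" "Ck_on k U f" "Ck_on k V f"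
  shows "Ck_on k (U \<union> V) f"
  using assms(3,4)
  by (induction k arbitrary: f) (auto intro: continuous_on_open_Un assms)

lemma Ck_on_subset: "Ck_on k U f \<Longrightarrow> V \<subseteq> U \<Longrightarrow> Ck_on k V f"
  by (induction k arbitrary: f) (auto intro: continuous_on_subset)

text \<open>Product and chain rules leave one factor undifferentiated; the inductions below use this
  to lower its order.\<close>

lemma Ck_on_SucD: "Ck_on (Suc k) U f \<Longrightarrow> Ck_on k U f"
proof (induction k arbitrary: f)
  case 0
  then show ?case
    by (auto intro!: continuous_at_imp_continuous_on differentiable_imp_continuous_within)
next
  case (Suc k)
  then show ?case by (metis Ck_on.simps(2))
qed

text \<open>On the open set \<open>U\<close> the operator \<open>dir_deriv\<close> agrees with any
  explicit derivative \<open>f'\<close>, so regularity can be checked on the formula; values off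
  \<open>U\<close> do not matter.\<close>

lemma Ck_on_SucI:
  assumes "open U" "\<And>z. z \<in> U \<Longrightarrow> (f has_derivative (\<lambda>v. f' v z)) (at z)"
    and "\<And>v. Ck_on k U (f' v)"
  shows "Ck_on (Suc k) U f"
proof (simp, intro conjI ballI allI)
  show "f differentiable (at z)" if "z \<in> U" for z
    using assms(2)[OF that] differentiableI by blast
  show "Ck_on k U (dir_deriv v f)" for v
    using dir_deriv_eq[OF assms(2)] by (intro Ck_on_cong[OF assms(1) assms(3)[of v]]) auto
qed

lemma Ck_on_const: "open U \<Longrightarrow> Ck_on k U (\<lambda>x. a)"
  by (induction k arbitrary: a)
    (auto intro!: Ck_on_SucI[where f' = "\<lambda>v z. 0"] simp del: Ck_on.simps(2))

lemma Ck_on_add: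
  assumes "open U" "Ck_on k U f" "Ck_on k U g"
  shows "Ck_on k U (\<lambda>x. f x + g x)"
  using assms(2,3)
proof (induction k arbitrary: f g)
  case 0
  then show ?case by (auto intro: continuous_intros)
next
  case (Suc k)
  show ?case
  proof (rule Ck_on_SucI[OF assms(1)])
    show "((\<lambda>x. f x + g x) has_derivative (\<lambda>v. (\<lambda>z. dir_deriv v f z + dir_deriv v g z) z)) (at z)"
      if "z \<in> U" for z
      using Suc.prems that by (auto intro!: has_derivative_add has_derivative_dir_deriv)
    show "Ck_on k U (\<lambda>z. dir_deriv v f z + dir_deriv v g z)" for v
      using Suc by auto
  qed
qed

lemma Ck_on_mult:
  assumes "open U" "Ck_on k U f" "Ck_on k U g"
  shows "Ck_on k U (\<lambda>x. f x * g x)"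
  using assms(2,3)
proof (induction k arbitrary: f g)
  case 0
  then show ?case by (auto intro: continuous_intros)
next
  case (Suc k)
  show ?case
  proof (rule Ck_on_SucI[OF assms(1)])
    show "((\<lambda>x. f x * g x) has_derivative
        (\<lambda>v. (\<lambda>z. f z * dir_deriv v g z + dir_deriv v f z * g z) z)) (at z)" if "z \<in> U" for z
      using Suc.prems that by (auto intro!: has_derivative_mult has_derivative_dir_deriv)
    show "Ck_on k U (\<lambda>z. f z * dir_deriv v g z + dir_deriv v f z * g z)" for v
      using Suc.prems Ck_on_SucD[OF Suc.prems(1)] Ck_on_SucD[OF Suc.prems(2)]
      by (intro Ck_on_add[OF assms(1)] Suc.IH) auto
  qed
qed

text \<open>The chain rule yields the derivative of \<open>h\<close> at \<open>f z\<close> times one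
  of \<open>f\<close>, so the induction replaces \<open>h\<close> by its derivative and keeps
  \<open>f\<close> fixed.\<close>

lemma Ck_on_compose:
  fixes h :: "real \<Rightarrow> real"
  assumes "open U" "Ck_on k V h" "Ck_on k U f" "\<And>z. z \<in> U \<Longrightarrow> f z \<in> V"
  shows "Ck_on k U (\<lambda>x. h (f x))"
  using assms(2,3)
proof (induction k arbitrary: h)
  case 0
  then show ?case
    using assms(4) continuous_on_compose2[of V h U f] by auto
next
  case (Suc k)
  show ?case
  proof (rule Ck_on_SucI[OF assms(1)])
    show "((\<lambda>x. h (f x)) has_derivative
        (\<lambda>v. (\<lambda>z. dir_deriv 1 h (f z) * dir_deriv v f z) z)) (at z)" if z: "z \<in> U" for z
    proof -
      have h: "(h has_derivative (\<lambda>v. dir_deriv v h (f z))) (at (f z))"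
        using Suc.prems assms(4)[OF z] by (auto intro!: has_derivative_dir_deriv)
      have "dir_deriv v h (f z) = dir_deriv 1 h (f z) * v" for v
        using linear_cmul[OF has_derivative_linear[OF h], of v 1] by (simp add: mult.commute)
      then have hd: "(h has_derivative (\<lambda>v. dir_deriv 1 h (f z) * v)) (at (f z))"
        using h by (metis (no_types, lifting) ext)
      have fd: "(f has_derivative (\<lambda>v. dir_deriv v f z)) (at z)"
        using Suc.prems z by (auto intro!: has_derivative_dir_deriv)
      show ?thesis
        by (rule has_derivative_compose[OF fd hd])
    qed
    show "Ck_on k U (\<lambda>z. dir_deriv 1 h (f z) * dir_deriv v f z)" for v
    proof (rule Ck_on_mult[OF assms(1)])
      show "Ck_on k U (\<lambda>z. dir_deriv 1 h (f z))"
        using Suc.prems by (auto intro: Suc.IH[OF _ Ck_on_SucD[OF Suc.prems(2)]])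
      show "Ck_on k U (dir_deriv v f)"
        using Suc.prems by simp
    qed
  qed
qed

lemma Ck_on_bounded_linear:
  assumes "bounded_linear f" "open U"
  shows "Ck_on k U f"
proof (cases k)
  case 0
  then show ?thesis using assms linear_continuous_on by auto
next
  case (Suc n)
  show ?thesis unfolding Suc
    using assms by (intro Ck_on_SucI[where f' = "\<lambda>v z. f v"] Ck_on_const)
      (auto intro: bounded_linear_imp_has_derivative)
qed

lemma Ck_on_SucI_real:
  fixes f :: "real \<Rightarrow> real"
  assumes "open U" "\<And>x. x \<in> U \<Longrightarrow> (f has_real_derivative f' x) (at x)" "Ck_on k U f'"
  shows "Ck_on (Suc k) U f"
  using assms
  by (intro Ck_on_SucI[where f' = "\<lambda>v x. f' x * v"] Ck_on_mult Ck_on_const)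
    (auto simp: has_field_derivative_def)

text \<open>The derivative is minus the square of the function itself, so the induction closes under
  products.\<close>

lemma Ck_on_inverse: "Ck_on k (- {0}) (inverse :: real \<Rightarrow> real)"
proof (induction k)
  case 0
  then show ?case by (auto intro: continuous_intros)
next
  case (Suc k)
  have "open (- {0::real})" by auto
  then have "Ck_on k (- {0}) (\<lambda>x. (- 1) * (inverse x * inverse x :: real))"
    by (intro Ck_on_mult Ck_on_const Suc)
  moreover have "(inverse has_real_derivative (- 1) * (inverse x * inverse x)) (at x)"
    if "x \<in> - {0}" for x :: real
    using that by (auto intro!: derivative_eq_intros simp: power2_eq_square)
  ultimately show ?case
    by (intro Ck_on_SucI_real) auto
qed

lemma Ck_on_sqrt: "Ck_on k {0<..} sqrt"
proof (induction k)
  case 0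
  then show ?case by (auto intro: continuous_intros)
next
  case (Suc k)
  have "Ck_on k {0<..} (\<lambda>x. (1/2) * (sqrt x * inverse x))"
    by (intro Ck_on_mult Ck_on_const Suc Ck_on_subset[OF Ck_on_inverse]) auto
  moreover have "(sqrt has_real_derivative (1/2) * (sqrt x * inverse x)) (at x)"
    if "x \<in> {0<..}" for x :: real
    using that by (auto intro!: derivative_eq_intros simp: field_simps)
  ultimately show ?case
    by (intro Ck_on_SucI_real) auto
qed

lemma Ck_on_norm_fst:
  "Ck_on k {z :: 'a::real_inner \<times> 'b::real_normed_vector. fst z \<noteq> a} (\<lambda>z. norm (fst z - a))"
proof -
  let ?U = "{z :: 'a \<times> 'b. fst z \<noteq> a}"
  have o: "open ?U"
    by (intro open_Collect_neq continuous_intros)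
  let ?N = "\<lambda>z :: 'a \<times> 'b. (fst z - a) \<bullet> (fst z - a)"
  have "Ck_on k ?U ?N"
  \<comment> \<open>Order \<open>Suc k\<close> is shown instead of \<open>k\<close>: the derivative
    of the squared norm is affine in \<open>z\<close>, hence of every order, and no case distinction
    on \<open>k\<close> arises.\<close>
  proof (rule Ck_on_SucD, rule Ck_on_SucI[OF o])
    show "(?N has_derivative (\<lambda>v. (\<lambda>z. 2 * (fst v \<bullet> fst z) + - (2 * (fst v \<bullet> a))) z)) (at z)" for z
      by (auto intro!: derivative_eq_intros simp: inner_diff_left inner_diff_right inner_commute)
    show "Ck_on k ?U (\<lambda>z. 2 * (fst v \<bullet> fst z) + - (2 * (fst v \<bullet> a)))" for v :: "'a \<times> 'b"
      by (intro Ck_on_add Ck_on_const o Ck_on_bounded_linear bounded_linear_const_mult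
          bounded_linear_inner_right_comp bounded_linear_fst)
  qed
  then have "Ck_on k ?U (\<lambda>z. sqrt (?N z))"
    by (intro Ck_on_compose[OF o Ck_on_sqrt]) auto
  then show ?thesis
    by (simp add: norm_eq_sqrt_inner)
qed

lemma smooth_has_real_derivative:
  fixes f :: "real \<Rightarrow> real"
  assumes "smooth f"
  shows "(f has_real_derivative deriv f x) (at x)"
proof -
  have "Ck (Suc 0) f" using assms unfolding smooth_def by blast
  then have "f differentiable (at x)" by simp
  then show ?thesis
    by (simp add: DERIV_deriv_iff_real_differentiable)
qed

lemma smooth_deriv:
  fixes f :: "real \<Rightarrow> real"
  assumes "smooth f"
  shows "smooth (deriv f)"
proof -
  have "dir_deriv 1 f = deriv f"
    using smooth_has_real_derivative[OF assms]
    by (intro ext) (metis dir_deriv_eq has_field_derivative_def mult.right_neutral)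
  moreover have "Ck k (dir_deriv 1 f)" for k
    using assms unfolding smooth_def by (meson Ck.simps(2))
  ultimately show ?thesis
    by (simp add: smooth_def)
qed

lemma smooth_continuous_on: "smooth f \<Longrightarrow> continuous_on A f"
  unfolding smooth_def by (metis Ck.simps(1) continuous_on_subset subset_UNIV)

lemma smooth_mult: "smooth f \<Longrightarrow> smooth g \<Longrightarrow> smooth (\<lambda>x. f x * g x)"
  unfolding smooth_def by (auto simp: Ck_on_UNIV[symmetric] intro: Ck_on_mult)

lemma smooth_affine:
  fixes f :: "real \<Rightarrow> real"
  assumes "smooth f"
  shows "smooth (\<lambda>x. f (a * x + b))"
  unfolding smooth_def
proof
  fix k
  have "Ck_on k UNIV (\<lambda>x. a * x + b)"
    by (intro Ck_on_add Ck_on_const Ck_on_bounded_linear bounded_linear_mult_right) auto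
  then show "Ck k (\<lambda>x. f (a * x + b))"
    using assms Ck_on_compose[of UNIV k UNIV f "\<lambda>x. a * x + b"]
    by (auto simp: smooth_def Ck_on_UNIV)
qed

section \<open>Smooth bump and step functions from exp(-1/x)\<close>

text \<open>The powers of 1/x are included so that the family is closed under differentiation;
  smoothness is then one induction for all \<open>n\<close> simultaneously.\<close>

definition flat :: "nat \<Rightarrow> real \<Rightarrow> real" where
  "flat n x = (if x > 0 then inverse x ^ n * exp (- inverse x) else 0)"

lemma flat_has_real_derivative:
  "(flat n has_real_derivative (- real n * flat (Suc n) x + flat (Suc (Suc n)) x)) (at x)"
proof (cases x "0 :: real" rule: linorder_cases)
  case less
  have "((\<lambda>x. 0) has_real_derivative 0) (at x)" by simp
  then show ?thesis
    using less has_field_derivative_transform_within_open[of "\<lambda>x. 0" 0 x "{..<0}" "flat n"]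
    by (auto simp: flat_def)
next
  case greater
  have *: "real n * (inverse x * inverse x ^ (n - Suc 0)) = real n * inverse x ^ n"
    by (cases n) auto
  have "((\<lambda>x. inverse x ^ n * exp (- inverse x)) has_real_derivative
     (- real n * flat (Suc n) x + flat (Suc (Suc n)) x)) (at x)"
    using greater *
    by (auto intro!: derivative_eq_intros simp: flat_def algebra_simps power2_eq_square)
  then show ?thesis
    using greater has_field_derivative_transform_within_open[of
        "\<lambda>x. inverse x ^ n * exp (- inverse x)" _ x "{0<..}" "flat n"]
    by (auto simp: flat_def)
next
  case equal
  have "((\<lambda>y. y ^ Suc n / exp y) \<longlongrightarrow> (0::real)) at_top"
    by (rule tendsto_power_div_exp_0)
  then have "((\<lambda>x. inverse x ^ Suc n / exp (inverse x)) \<longlongrightarrow> (0::real)) (at_right 0)"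
    by (rule filterlim_compose) (rule filterlim_inverse_at_top_right)
  then have "(flat (Suc n) \<longlongrightarrow> 0) (at_right 0)"
    by (rule Lim_transform_eventually)
      (auto simp: flat_def exp_minus field_simps eventually_at_filter)
  moreover have "(flat (Suc n) \<longlongrightarrow> 0) (at_left 0)"
    by (rule Lim_transform_eventually[OF tendsto_const])
      (auto simp: flat_def eventually_at_filter)
  ultimately have "(flat (Suc n) \<longlongrightarrow> 0) (at 0)"
    by (simp add: filterlim_at_split)
  \<comment> \<open>The difference quotient of \<open>flat n\<close> at 0 is
    \<open>flat (Suc n)\<close>, so the limit just computed is the derivative there.\<close>
  moreover have "flat n y / y = flat (Suc n) y" for y
    by (simp add: flat_def field_simps)
  moreover have "flat m 0 = 0" for m
    by (simp add: flat_def)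
  ultimately show ?thesis
    unfolding equal by (simp add: has_field_derivative_iff)
qed

lemma smooth_flat: "smooth (flat n)"
proof -
  have "Ck_on k UNIV (flat n)" for k
  proof (induction k arbitrary: n)
    case 0
    then show ?case
      using flat_has_real_derivative
      by (auto intro!: continuous_at_imp_continuous_on DERIV_isCont)
  next
    case (Suc k)
    then have "Ck_on k UNIV (\<lambda>x. - real n * flat (Suc n) x + flat (Suc (Suc n)) x)"
      by (intro Ck_on_add Ck_on_mult Ck_on_const) auto
    with flat_has_real_derivative show ?case
      by (rule Ck_on_SucI_real[OF open_UNIV])
  qed
  then show ?thesis by (simp add: smooth_def Ck_on_UNIV)
qed

lemma flat_nonneg: "flat n x \<ge> 0" and flat_pos_iff: "flat n x > 0 \<longleftrightarrow> x > 0"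
  by (auto simp: flat_def)

text \<open>Vanishes off (-1, 1). It is not normalised; its positive integral is cancelled at the
  end.\<close>

definition smooth_bump :: "real \<Rightarrow> real" where
  "smooth_bump x = flat 0 (1 + x) * flat 0 (1 - x)"

lemma smooth_smooth_bump: "smooth smooth_bump"
  unfolding smooth_bump_def
  using smooth_affine[OF smooth_flat[of 0], of 1 1] smooth_affine[OF smooth_flat[of 0], of "-1" 1]
  by (intro smooth_mult) (auto simp: add.commute)

lemma smooth_bump_nonneg: "smooth_bump x \<ge> 0"
  by (simp add: smooth_bump_def flat_nonneg)

lemma smooth_bump_eq_0: "\<bar>x\<bar> \<ge> 1 \<Longrightarrow> smooth_bump x = 0"
  by (auto simp: smooth_bump_def flat_def)

lemma smooth_bump_0: "smooth_bump 0 > 0"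
  by (simp add: smooth_bump_def flat_def)

text \<open>The standard transition from 0 to 1 over [0, 1]; the two summands of the denominator
  never vanish together.\<close>

definition smooth_step :: "real \<Rightarrow> real" where
  "smooth_step x = flat 0 x * inverse (flat 0 x + flat 0 (1 - x))"

lemma smooth_smooth_step: "smooth smooth_step"
  unfolding smooth_def
proof
  fix k
  have 1: "Ck_on k UNIV (flat 0)" and 2: "Ck_on k UNIV (\<lambda>x. flat 0 (1 - x))"
    using smooth_flat[of 0] smooth_affine[OF smooth_flat[of 0], of "-1" 1]
    by (auto simp: smooth_def Ck_on_UNIV)
  have "flat 0 x + flat 0 (1 - x) > 0" for x
    using flat_nonneg[of 0 x] flat_nonneg[of 0 "1 - x"] flat_pos_iff[of 0 x]
      flat_pos_iff[of 0 "1 - x"] by linarith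
  then have "flat 0 x + flat 0 (1 - x) \<in> - {0}" for x
    by (metis ComplI order_less_irrefl singletonD)
  then have "Ck_on k UNIV (\<lambda>x. inverse (flat 0 x + flat 0 (1 - x)))"
    by (intro Ck_on_compose[OF _ Ck_on_inverse] Ck_on_add 1 2) auto
  then show "Ck k smooth_step"
    using Ck_on_mult[OF _ 1, of "\<lambda>x. inverse (flat 0 x + flat 0 (1 - x))"]
    by (simp add: Ck_on_UNIV smooth_step_def[abs_def])
qed

lemma smooth_step_eq_0: "x \<le> 0 \<Longrightarrow> smooth_step x = 0"
  by (simp add: smooth_step_def flat_def)

lemma smooth_step_eq_1: "x \<ge> 1 \<Longrightarrow> smooth_step x = 1"
  by (simp add: smooth_step_def flat_def)

lemma deriv_eq_0_open:
  fixes f :: "real \<Rightarrow> real"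
  assumes "open U" "x \<in> U" "\<And>y. y \<in> U \<Longrightarrow> f y = a"
  shows "deriv f x = 0"
proof -
  have "((\<lambda>x. a) has_real_derivative 0) (at x)" by simp
  from has_field_derivative_transform_within_open[OF this assms(1,2)] assms(3)
  have "(f has_real_derivative 0) (at x)" by auto
  then show ?thesis by (rule DERIV_imp_deriv)
qed

lemma bounded_of_zero_outside:
  fixes f :: "real \<Rightarrow> real"
  assumes "continuous_on UNIV f" "\<And>x. x < a \<or> x > b \<Longrightarrow> f x = 0"
  obtains B where "B > 0" "\<And>x. \<bar>f x\<bar> \<le> B"
proof -
  have "compact (f ` {a..b})"
    by (intro compact_continuous_image continuous_on_subset[OF assms(1)]) auto
  then obtain B where B: "B > 0" "\<And>x. x \<in> {a..b} \<Longrightarrow> norm (f x) \<le> B"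
    using compact_imp_bounded bounded_pos by (metis image_eqI)
  show ?thesis
  proof (rule that[OF B(1)])
    show "\<bar>f x\<bar> \<le> B" for x
      using B assms(2)[of x] by (cases "x \<in> {a..b}") auto
  qed
qed

subsection \<open>Backward spherical waves as test functions\<close>

text \<open>An amplitude times a profile of the phase \<open>c t + r\<close>, which for
  \<open>c > 0\<close> travels towards \<open>a\<close>. Both slots are kept free because
  differentiation reproduces such products with other amplitudes and profiles.\<close>

definition radial_wave ::
  "'a::real_inner \<Rightarrow> real \<Rightarrow> (real \<Rightarrow> real) \<Rightarrow> (real \<Rightarrow> real) \<Rightarrow> 'a \<times> real \<Rightarrow> real" where
  "radial_wave a c \<alpha> \<beta> z = \<alpha> (norm (fst z - a)) * \<beta> (c * snd z + norm (fst z - a))"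

text \<open>The gradient of r is (x - a) / r. With the vector x - a taken out and 1/r left in the
  amplitude, every remaining factor is a \<open>radial_wave\<close>, so the rule can be applied a
  second time.\<close>

lemma radial_wave_has_derivative:
  assumes "fst z \<noteq> a"
    and \<alpha>: "\<And>r. r > 0 \<Longrightarrow> (\<alpha> has_real_derivative \<alpha>' r) (at r)"
    and \<beta>: "\<And>s. (\<beta> has_real_derivative \<beta>' s) (at s)"
  shows "(radial_wave a c \<alpha> \<beta> has_derivative
    (\<lambda>v. ((fst z - a) \<bullet> fst v) * (radial_wave a c (\<lambda>r. \<alpha>' r / r) \<beta> z
        + radial_wave a c (\<lambda>r. \<alpha> r / r) \<beta>' z)
      + snd v * (c * radial_wave a c \<alpha> \<beta>' z))) (at z)"
proof -
  let ?r = "norm (fst z - a)"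
  have r: "?r > 0" using assms(1) by simp
  have N: "((\<lambda>z. norm (fst z - a)) has_derivative (\<lambda>v. (fst z - a) \<bullet> fst v / ?r)) (at z)"
  proof -
    have L: "((\<lambda>z. fst z - a) has_derivative fst) (at z)"
      by (auto intro!: derivative_eq_intros)
    show ?thesis
      by (rule has_derivative_eq_rhs[OF has_derivative_compose[OF L has_derivative_norm]])
        (use assms(1) in \<open>auto simp: sgn_div_norm inner_commute divide_inverse_commute\<close>)
  qed
  have A: "((\<lambda>z. \<alpha> (norm (fst z - a))) has_derivative
      (\<lambda>v. \<alpha>' ?r * ((fst z - a) \<bullet> fst v / ?r))) (at z)"
    using has_derivative_compose[OF N \<alpha>[OF r, unfolded has_field_derivative_def]] .
  have "((\<lambda>z. c * snd z + norm (fst z - a)) has_derivative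
      (\<lambda>v. c * snd v + (fst z - a) \<bullet> fst v / ?r)) (at z)"
    by (auto intro!: derivative_eq_intros N)
  from has_derivative_compose[OF this \<beta>[unfolded has_field_derivative_def]]
  have B: "((\<lambda>z. \<beta> (c * snd z + norm (fst z - a))) has_derivative
      (\<lambda>v. \<beta>' (c * snd z + ?r) * (c * snd v + (fst z - a) \<bullet> fst v / ?r))) (at z)" .
  show ?thesis
    unfolding radial_wave_def[abs_def]
    by (rule has_derivative_eq_rhs[OF has_derivative_mult[OF A B]]) (simp add: algebra_simps)
qed

lemma DERIV_divide_self:
  fixes f :: "real \<Rightarrow> real"
  assumes "(f has_real_derivative f') (at r)" "r > 0"
  shows "((\<lambda>r. f r / r) has_real_derivative (f' / r - f r / r\<^sup>2)) (at r)"
  using assms by (auto intro!: derivative_eq_intros simp: power2_eq_square field_simps)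

lemma dir_deriv_cong_has_derivative:
  assumes "open U" "z \<in> U" "\<And>w. w \<in> U \<Longrightarrow> f w = g w" "(g has_derivative g') (at z)"
  shows "dir_deriv v f z = g' v"
proof -
  have "(f has_derivative g') (at z)"
    using has_derivative_transform_within_open[OF assms(4,1,2), of f] assms(3) by simp
  then show ?thesis by (rule dir_deriv_eq)
qed

context
  fixes a :: "real^3" and c :: real and g g' g'' h h' h'' :: "real \<Rightarrow> real"
  assumes c: "c > 0"
    and g: "\<And>r. (g has_real_derivative g' r) (at r)" "\<And>r. (g' has_real_derivative g'' r) (at r)"
    and h: "\<And>r. (h has_real_derivative h' r) (at r)" "\<And>r. (h' has_real_derivative h'' r) (at r)"
begin

text \<open>In three dimensions the Laplacian of a radial function F / r is F_rr / r. For F = g h(c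
  t + r) the terms \<open>g h''\<close> from time and space cancel, leaving those in which
  \<open>g\<close> is differentiated.\<close>

lemma dalembertian_radial_wave_off_center:
  fixes z :: "(real^3) \<times> real"
  defines "\<Phi> \<equiv> radial_wave a c (\<lambda>r. g r / r) h" and "r \<equiv> norm (fst z - a)"
  assumes z: "fst z \<noteq> a"
  shows "(1 / c\<^sup>2) * dir_deriv (0, 1) (dir_deriv (0, 1) \<Phi>) z
      - (\<Sum>b\<in>Basis. dir_deriv (b, 0) (dir_deriv (b, 0) \<Phi>) z)
    = - (g'' r * h (c * snd z + r) + 2 * g' r * h' (c * snd z + r)) / r"
proof -
  define U :: "((real^3) \<times> real) set" where "U = {z. fst z \<noteq> a}"
  have U: "open U" "z \<in> U"
    using z unfolding U_def by (auto intro!: open_Collect_neq continuous_intros)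
  define \<alpha> where "\<alpha> = (\<lambda>r. g r / r)"
  define \<alpha>' where "\<alpha>' = (\<lambda>r. g' r / r - g r / r\<^sup>2)"
  define \<alpha>'' where "\<alpha>'' = (\<lambda>r. g'' r / r - 2 * g' r / r\<^sup>2 + 2 * g r / r ^ 3)"
  have \<alpha>: "(\<alpha> has_real_derivative \<alpha>' r) (at r)" if "r > 0" for r
    unfolding \<alpha>_def \<alpha>'_def using g that by (intro DERIV_divide_self)
  have \<alpha>': "(\<alpha>' has_real_derivative \<alpha>'' r) (at r)" if "r > 0" for r
    unfolding \<alpha>'_def \<alpha>''_def using that
    by (auto intro!: derivative_eq_intros g simp: power2_eq_square power3_eq_cube field_simps)
  have \<Phi>: "\<Phi> = radial_wave a c \<alpha> h"
    by (simp add: \<Phi>_def \<alpha>_def)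
  note D = radial_wave_has_derivative[where a = a and c = c]
  have t1: "dir_deriv (0, 1) \<Phi> w = c * radial_wave a c \<alpha> h' w" if "w \<in> U" for w
    unfolding \<Phi> using that
    by (subst dir_deriv_eq[OF D[of w, OF _ \<alpha> h(1)]]) (auto simp: U_def)
  have t2: "dir_deriv (0, 1) (dir_deriv (0, 1) \<Phi>) z = c * (c * radial_wave a c \<alpha> h'' z)"
    using dir_deriv_cong_has_derivative[OF U t1
        has_derivative_mult_right[OF D[of z, OF z \<alpha> h(2)]]] by simp
  \<comment> \<open>\<open>?G\<close> is (1/r) d/dr of \<open>\<Phi>\<close> and \<open>H\<close> is
    (1/r) d/dr of \<open>?G\<close>; the Laplacian is then 3 G + r^2 H.\<close>
  let ?G = "\<lambda>w. radial_wave a c (\<lambda>r. \<alpha>' r / r) h w + radial_wave a c (\<lambda>r. \<alpha> r / r) h' w"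
  have x1: "dir_deriv (b, 0) \<Phi> w = ((fst w - a) \<bullet> b) * ?G w" if "w \<in> U" for w b
    unfolding \<Phi> using that
    by (subst dir_deriv_eq[OF D[of w, OF _ \<alpha> h(1)]]) (auto simp: U_def)
  define H where "H = radial_wave a c (\<lambda>r. (\<alpha>'' r / r - \<alpha>' r / r\<^sup>2) / r) h z
    + radial_wave a c (\<lambda>r. \<alpha>' r / r / r) h' z
    + (radial_wave a c (\<lambda>r. (\<alpha>' r / r - \<alpha> r / r\<^sup>2) / r) h' z
    + radial_wave a c (\<lambda>r. \<alpha> r / r / r) h'' z)"
  have x2: "dir_deriv (b, 0) (dir_deriv (b, 0) \<Phi>) z = (b \<bullet> b) * ?G z + ((fst z - a) \<bullet> b)\<^sup>2 * H"
    for b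
  proof -
    have L: "((\<lambda>w. (fst w - a) \<bullet> b) has_derivative (\<lambda>v. fst v \<bullet> b)) (at z)"
      by (auto intro!: derivative_eq_intros)
    note G = has_derivative_add[OF D[of z, OF z DERIV_divide_self[OF \<alpha>'] h(1)]
        D[of z, OF z DERIV_divide_self[OF \<alpha>] h(2)]]
    show ?thesis
      using dir_deriv_cong_has_derivative[OF U x1[of _ b] has_derivative_mult[OF L G], of "(b, 0)"]
      by (simp add: H_def algebra_simps power2_eq_square)
  qed
  have "(\<Sum>b\<in>Basis. dir_deriv (b, 0) (dir_deriv (b, 0) \<Phi>) z)
      = (\<Sum>b\<in>(Basis :: (real^3) set). b \<bullet> b) * ?G z + (\<Sum>b\<in>Basis. ((fst z - a) \<bullet> b)\<^sup>2) * H"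
    unfolding x2 by (simp add: sum.distrib sum_distrib_right)
  also have "(\<Sum>b\<in>(Basis :: (real^3) set). b \<bullet> b) = 3"
    by simp
  also have "(\<Sum>b\<in>Basis. ((fst z - a) \<bullet> b)\<^sup>2) = r\<^sup>2"
    unfolding r_def power2_norm_eq_inner euclidean_inner[of "fst z - a" "fst z - a"]
    by (simp add: power2_eq_square)
  finally have E: "(1 / c\<^sup>2) * dir_deriv (0, 1) (dir_deriv (0, 1) \<Phi>) z
      - (\<Sum>b\<in>Basis. dir_deriv (b, 0) (dir_deriv (b, 0) \<Phi>) z)
    = radial_wave a c \<alpha> h'' z - (3 * ?G z + r\<^sup>2 * H)"
    unfolding t2 using c by (simp add: power2_eq_square)
  have "r > 0" using z by (simp add: r_def)
  then show ?thesis
    unfolding E H_def radial_wave_def r_def[symmetric] \<alpha>_def \<alpha>'_def \<alpha>''_def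
    by (simp add: divide_simps power2_eq_square power3_eq_cube) (simp add: algebra_simps)
qed

end

section \<open>The wave operator on test functions\<close>

definition dalembertian :: "real \<Rightarrow> (spacetime \<Rightarrow> real) \<Rightarrow> spacetime \<Rightarrow> real" where
  "dalembertian c \<phi> z = (1 / c\<^sup>2) * dir_deriv (0, 1) (dir_deriv (0, 1) \<phi>) z
     - (\<Sum>b\<in>Basis. dir_deriv (b, 0) (dir_deriv (b, 0) \<phi>) z)"

lemma dir_deriv_eq_0_open:
  assumes "open U" "z \<in> U" "\<And>w. w \<in> U \<Longrightarrow> f w = 0"
  shows "dir_deriv v f z = 0"
  using dir_deriv_cong_has_derivative[OF assms has_derivative_const] by simp

text \<open>Solutions are only locally integrable; the second factor vanishing off \<open>K\<close>
  makes the pairing a global integral.\<close>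

lemma integrable_absolutely_integrable_times_continuous:
  fixes f g :: "'a::euclidean_space \<Rightarrow> real"
  assumes "compact K" "f absolutely_integrable_on K" "continuous_on UNIV g"
    and "\<And>z. z \<notin> K \<Longrightarrow> g z = 0"
  shows "integrable lebesgue (\<lambda>z. f z * g z)"
proof -
  have "K \<in> sets lebesgue"
    using assms(1) by (simp add: compact_imp_closed borel_closed sets_completionI_sets)
  moreover have "g \<in> borel_measurable (lebesgue_on K)"
    using assms(1,3)
    by (intro continuous_imp_measurable_on_sets_lebesgue)
      (auto intro: continuous_on_subset simp: compact_imp_closed borel_closed sets_completionI_sets)
  moreover have "bounded (g ` K)"
    using assms(1,3) compact_continuous_image[of K g]
    by (metis compact_imp_bounded continuous_on_subset subset_UNIV)
  ultimately have "(\<lambda>z. g z * f z) absolutely_integrable_on K"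
    using assms(2) by (intro absolutely_integrable_bounded_measurable_product[OF bilinear_times])
  moreover have "(\<lambda>z. indicat_real K z *\<^sub>R (g z * f z)) = (\<lambda>z. f z * g z)"
    using assms(4) by (auto simp: indicator_def fun_eq_iff)
  ultimately show ?thesis
    by (simp add: set_integrable_def)
qed

text \<open>Every derivative in the operator occurs twice, so the signs in
  \<open>distr_deriv\<close> cancel and the operator moves unchanged onto \<open>\<phi>\<close>.
  Each term is integrable by itself, which permits splitting the integral.\<close>

lemma wave_op_distr_of:
  assumes \<phi>: "test_function \<phi>"
    and u: "\<And>K. compact K \<Longrightarrow> (\<lambda>(x, t). u x t) absolutely_integrable_on K"
  shows "integrable lebesgue (\<lambda>z. (case z of (x, t) \<Rightarrow> u x t) * dalembertian c \<phi> z)"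
    and "wave_op c (distr_of u) \<phi>
      = (LINT z|lebesgue. (case z of (x, t) \<Rightarrow> u x t) * dalembertian c \<phi> z)"
proof -
  define f where "f = (\<lambda>z :: spacetime. case z of (x, t) \<Rightarrow> u x t)"
  define K where "K = closure {z. \<phi> z \<noteq> 0}"
  have K: "compact K" using \<phi> by (simp add: K_def test_function_def)
  have 0: "\<phi> z = 0" if "z \<in> - K" for z
    using that closure_subset[of "{z. \<phi> z \<noteq> 0}"] by (auto simp: K_def)
  have o: "open (- K)" using K by (simp add: compact_imp_closed open_Compl)
  have d0: "dir_deriv v (dir_deriv v \<phi>) z = 0" if "z \<in> - K" for v z
    using o 0 that by (intro dir_deriv_eq_0_open[OF o])
  have "Ck (Suc (Suc 0)) \<phi>"
    using \<phi> by (auto simp: test_function_def smooth_def simp del: Ck.simps)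
  then have "continuous_on UNIV (dir_deriv v (dir_deriv v \<phi>))" for v
    by (meson Ck.simps)
  then have I: "integrable lebesgue (\<lambda>z. f z * dir_deriv v (dir_deriv v \<phi>) z)" for v
    using u[OF K] d0 unfolding f_def
    by (intro integrable_absolutely_integrable_times_continuous[OF K]) auto
  have DD: "distr_deriv v (distr_deriv v (distr_of u)) \<phi>
      = (LINT z|lebesgue. f z * dir_deriv v (dir_deriv v \<phi>) z)" for v
    unfolding distr_deriv_def distr_of_def f_def
    by (simp, intro Bochner_Integration.integral_cong) auto
  have E: "f z * dalembertian c \<phi> z
      = (1 / c\<^sup>2) * (f z * dir_deriv (0, 1) (dir_deriv (0, 1) \<phi>) z)
        - (\<Sum>b\<in>Basis. f z * dir_deriv (b, 0) (dir_deriv (b, 0) \<phi>) z)" for z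
    by (simp add: dalembertian_def sum_distrib_left algebra_simps)
  show "integrable lebesgue (\<lambda>z. (case z of (x, t) \<Rightarrow> u x t) * dalembertian c \<phi> z)"
    unfolding f_def[symmetric] E
    by (intro Bochner_Integration.integrable_diff integrable_mult_right Bochner_Integration.integrable_sum I)
  show "wave_op c (distr_of u) \<phi>
      = (LINT z|lebesgue. (case z of (x, t) \<Rightarrow> u x t) * dalembertian c \<phi> z)"
    unfolding wave_op_def DD unfolding f_def[symmetric] E
    by (subst Bochner_Integration.integral_diff)
      (auto intro!: integrable_mult_right Bochner_Integration.integrable_sum I simp: Bochner_Integration.integral_sum I)
qed

text \<open>Off the axis x = a the wave is composed of smooth functions, near the axis it is 0, and
  the two open sets cover space-time. On the support, the bounds on r and \<open>c t + r\<close>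
  also bound t.\<close>

lemma test_function_radial_wave:
  assumes "c > 0" "smooth g" "smooth h" "\<epsilon> > 0"
    and g: "\<And>r. r < \<epsilon> \<Longrightarrow> g r = 0" "\<And>r. r > R \<Longrightarrow> g r = 0"
    and h: "\<And>s. \<bar>s\<bar> > B \<Longrightarrow> h s = 0"
  shows "test_function (radial_wave a c (\<lambda>r. g r / r) h)"
proof -
  let ?\<Phi> = "radial_wave a c (\<lambda>r. g r / r) h"
  have "Ck k ?\<Phi>" for k
  proof -
    define U where "U = {z :: spacetime. fst z \<noteq> a}"
    define V where "V = {z :: spacetime. norm (fst z - a) < \<epsilon>}"
    have o: "open U" "open V"
      unfolding U_def V_def
      by (intro open_Collect_neq open_Collect_less continuous_intros)+
    have N: "Ck_on k U (\<lambda>z. norm (fst z - a))"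
      unfolding U_def by (rule Ck_on_norm_fst)
    have "Ck_on k U (\<lambda>z. c * snd z + norm (fst z - a))"
      by (intro Ck_on_add N o Ck_on_bounded_linear bounded_linear_const_mult bounded_linear_snd)
    then have H: "Ck_on k U (\<lambda>z. h (c * snd z + norm (fst z - a)))"
      using assms(3) o(1) by (intro Ck_on_compose[of U k UNIV h]) (auto simp: smooth_def Ck_on_UNIV)
    have G: "Ck_on k U (\<lambda>z. g (norm (fst z - a)))"
      using assms(2) o(1) N by (intro Ck_on_compose[of U k UNIV g]) (auto simp: smooth_def Ck_on_UNIV)
    have J: "Ck_on k U (\<lambda>z. inverse (norm (fst z - a)))"
      by (intro Ck_on_compose[OF o(1) Ck_on_inverse N]) (auto simp: U_def)
    have "Ck_on k U ?\<Phi>"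
      using Ck_on_mult[OF o(1) Ck_on_mult[OF o(1) G J] H]
      by (simp add: radial_wave_def[abs_def] divide_inverse)
    moreover have "Ck_on k V ?\<Phi>"
      using g(1) by (intro Ck_on_cong[OF o(2) Ck_on_const[OF o(2), of k 0]])
        (auto simp: V_def radial_wave_def)
    moreover have "U \<union> V = UNIV"
      using assms(4) by (auto simp: U_def V_def)
    ultimately show ?thesis
      using Ck_on_union[OF o] by (simp add: Ck_on_UNIV)
  qed
  moreover have "bounded {z. ?\<Phi> z \<noteq> 0}"
  proof (rule bounded_subset)
    show "bounded (cball a R \<times> {- ((B + R) / c)..B / c})"
      by (intro bounded_Times) auto
    show "{z. ?\<Phi> z \<noteq> 0} \<subseteq> cball a R \<times> {- ((B + R) / c)..B / c}"
    proof
      fix z assume "z \<in> {z. ?\<Phi> z \<noteq> 0}"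
      then have "g (norm (fst z - a)) \<noteq> 0" "h (c * snd z + norm (fst z - a)) \<noteq> 0"
        by (auto simp: radial_wave_def)
      then have 1: "norm (fst z - a) \<le> R" "\<bar>c * snd z + norm (fst z - a)\<bar> \<le> B"
        using g(2) h not_le by blast+
      then have "c * snd z \<le> B" "c * snd z \<ge> - (B + R)"
        using norm_ge_zero[of "fst z - a"] by linarith+
      then show "z \<in> cball a R \<times> {- ((B + R) / c)..B / c}"
        using 1 assms(1) by (cases z) (auto simp: dist_norm norm_minus_commute field_simps)
    qed
  qed
  ultimately show ?thesis
    by (simp add: test_function_def smooth_def compact_closure)
qed

lemma dalembertian_radial_wave:
  fixes a :: "real^3" and z :: spacetime
  assumes "c > 0" "smooth g" "smooth h" "\<epsilon> > 0" and g: "\<And>r. r < \<epsilon> \<Longrightarrow> g r = 0"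
  defines "r \<equiv> norm (fst z - a)"
  shows "dalembertian c (radial_wave a c (\<lambda>r. g r / r) h) z
    = - (deriv (deriv g) r * h (c * snd z + r)
        + 2 * deriv g r * deriv h (c * snd z + r)) / r"
proof (cases "fst z = a")
  case True
  define V where "V = {z :: spacetime. norm (fst z - a) < \<epsilon>}"
  have V: "open V" "z \<in> V"
    unfolding V_def using True assms(4) by (auto intro!: open_Collect_less continuous_intros)
  have "radial_wave a c (\<lambda>r. g r / r) h w = 0" if "w \<in> V" for w
    using g that by (auto simp: V_def radial_wave_def)
  then have "dir_deriv v (dir_deriv v (radial_wave a c (\<lambda>r. g r / r) h)) z = 0" for v
    using V by (intro dir_deriv_eq_0_open[OF V(1)]) auto
  \<comment> \<open>On the axis the right-hand side is a division by \<open>r = 0\<close>, hence 0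
    in HOL.\<close>
  then show ?thesis
    using True by (simp add: dalembertian_def r_def)
next
  case False
  note d = smooth_has_real_derivative
  show ?thesis
    unfolding dalembertian_def r_def
    by (rule dalembertian_radial_wave_off_center[OF assms(1) d d d d])
      (use assms(2,3) smooth_deriv False in auto)
qed

subsection \<open>Retarded potentials\<close>

text \<open>The explicit solution times 4 pi: the normalisation that appears when sources are paired
  with a test wave of amplitude 1/r.\<close>

definition retarded_potential ::
  "real \<Rightarrow> (real \<Rightarrow> real) \<Rightarrow> nat \<Rightarrow> (nat \<Rightarrow> real) \<Rightarrow> (nat \<Rightarrow> 'a::real_normed_vector) \<Rightarrow> 'a \<Rightarrow> real \<Rightarrow> real"
  where "retarded_potential c lam M a s x t
    = (\<Sum>j=1..M. a j * lam (t - norm (x - s j) / c) / norm (x - s j))"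

lemma continuous_on_retarded_potential:
  assumes "continuous_on UNIV lam"
  shows "continuous_on A (retarded_potential c lam M a s x)"
proof -
  have "continuous_on A (\<lambda>t. lam (t - norm (x - s j) / c))" for j
    by (intro continuous_on_compose2[OF assms]) (auto intro: continuous_intros)
  then show ?thesis
    unfolding retarded_potential_def[abs_def] divide_inverse
    by (intro continuous_intros) (auto simp: divide_inverse)
qed

lemma integrable_lborel_zero_outside:
  fixes f :: "real \<Rightarrow> real"
  assumes "continuous_on UNIV f" "\<And>x. x < a \<or> x > b \<Longrightarrow> f x = 0"
  shows "integrable lborel f"
proof -
  have "integrable lborel (\<lambda>x. indicator {a..b} x *\<^sub>R f x)"
    by (intro borel_integrable_compact continuous_on_subset[OF assms(1)]) auto
  moreover have "f x = 0" if "x \<notin> {a..b}" for x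
    using that assms(2)[of x] by auto
  then have "(\<lambda>x. indicator {a..b} x *\<^sub>R f x) = f"
    by (auto simp: indicator_def fun_eq_iff)
  ultimately show ?thesis by simp
qed

lemma integrable_times_smooth_bump:
  assumes "continuous_on UNIV f"
  shows "integrable lborel (\<lambda>\<sigma>. f \<sigma> * smooth_bump \<sigma>)"
  by (rule integrable_lborel_zero_outside[of _ "- 1" 1])
    (auto intro!: smooth_bump_eq_0
      continuous_on_mult[OF assms smooth_continuous_on[OF smooth_smooth_bump]])

text \<open>A source at \<open>s j\<close> sees the test wave only on the line x = s_j, where
  \<open>g\<close> is 1 and the profile is concentrated around t0 - r_j/c. Substituting t = t0 -
  r_j/c + (\<epsilon>/c) \<sigma> centres all profiles at 0; this shift by the travel time produces
  the retarded argument.\<close>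

lemma point_sources_radial_wave:
  assumes "c > 0" "\<epsilon> > 0" "continuous_on UNIV lam"
    and g: "\<And>j. j \<in> {1..M} \<Longrightarrow> g (norm (x0 - s j)) = 1"
  shows "point_sources lam M a s
      (radial_wave x0 c (\<lambda>r. g r / r) (\<lambda>\<sigma>. smooth_bump ((\<sigma> - c * t0) / \<epsilon>)))
    = \<epsilon> / c * (LINT \<sigma>|lborel. retarded_potential c lam M a s x0 (t0 + \<epsilon> / c * \<sigma>) * smooth_bump \<sigma>)"
proof -
  define r where "r j = norm (x0 - s j)" for j
  have b: "continuous_on A (\<lambda>t. smooth_bump ((c * t + r - c * t0) / \<epsilon>))" for A r
    by (intro continuous_on_compose2[OF smooth_continuous_on[OF smooth_smooth_bump]])
      (use assms(2) in \<open>auto intro!: continuous_intros\<close>)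
  let ?f = "\<lambda>j t. lam t * smooth_bump ((c * t + r j - c * t0) / \<epsilon>)"
  have f: "continuous_on UNIV (?f j)" for j
    by (intro continuous_intros assms b)
  have I: "integrable lborel (?f j)" for j
  proof (rule integrable_lborel_zero_outside[OF f])
    fix t assume "t < t0 - r j / c - \<epsilon> / c \<or> t > t0 - r j / c + \<epsilon> / c"
    then have "\<epsilon> / c \<le> \<bar>t - (t0 - r j / c)\<bar>"
      by linarith
    also have "\<dots> = \<bar>c * t + r j - c * t0\<bar> / c"
    proof -
      have "t - (t0 - r j / c) = (c * t + r j - c * t0) / c"
        using assms(1) by (simp add: field_simps)
      then show ?thesis using assms(1) by simp
    qed
    finally have "\<bar>c * t + r j - c * t0\<bar> \<ge> \<epsilon>"
      using assms(1) by (simp add: divide_le_cancel)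
    then have "\<bar>(c * t + r j - c * t0) / \<epsilon>\<bar> \<ge> 1"
      using assms(2) by (simp add: field_simps)
    then show "?f j t = 0"
      using smooth_bump_eq_0 by auto
  qed
  have L: "continuous_on UNIV (\<lambda>\<sigma>. lam (t0 + \<epsilon> / c * \<sigma> - r j / c))" for j
    by (intro continuous_on_compose2[OF assms(3)])
      (use assms(1) in \<open>auto intro!: continuous_intros\<close>)
  have sub: "(LINT t|lborel. ?f j t)
      = \<epsilon> / c * (LINT \<sigma>|lborel. lam (t0 + \<epsilon> / c * \<sigma> - r j / c) * smooth_bump \<sigma>)" for j
  proof -
    have subst: "(LINT t|lborel. ?f j t) = \<bar>\<epsilon> / c\<bar> *\<^sub>R (LINT \<sigma>|lborel. ?f j ((t0 - r j / c) + \<epsilon> / c * \<sigma>))"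
      using assms(1,2) by (intro lborel_integral_real_affine) auto
    have arg: "(c * ((t0 - r j / c) + \<epsilon> / c * \<sigma>) + r j - c * t0) / \<epsilon> = \<sigma>" for \<sigma>
      using assms(1,2) by (simp add: field_simps)
    show ?thesis
      unfolding subst arg using assms(1,2) by (simp add: algebra_simps)
  qed
  have "point_sources lam M a s
      (radial_wave x0 c (\<lambda>r. g r / r) (\<lambda>\<sigma>. smooth_bump ((\<sigma> - c * t0) / \<epsilon>)))
    = (LINT t|lebesgue. (\<Sum>j=1..M. a j / r j * ?f j t))"
    unfolding point_sources_def dirac_def radial_wave_def
    using g by (intro Bochner_Integration.integral_cong refl)
      (auto simp: sum_distrib_left r_def norm_minus_commute intro!: sum.cong)
  also have "\<dots> = (LINT t|lborel. (\<Sum>j=1..M. a j / r j * ?f j t))"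
  proof (rule integral_completion)
    have "continuous_on UNIV (\<lambda>t. \<Sum>j=1..M. a j / r j * ?f j t)"
      by (intro continuous_on_sum continuous_on_mult[OF continuous_on_const f])
    then show "(\<lambda>t. \<Sum>j=1..M. a j / r j * ?f j t) \<in> borel_measurable lborel"
      by (simp add: borel_measurable_continuous_onI)
  qed
  also have "\<dots> = (\<Sum>j=1..M. a j / r j * (LINT t|lborel. ?f j t))"
    by (subst Bochner_Integration.integral_sum) (auto intro!: integrable_mult_right I)
  also have "\<dots> = \<epsilon> / c *
      (\<Sum>j=1..M. a j / r j * (LINT \<sigma>|lborel. lam (t0 + \<epsilon> / c * \<sigma> - r j / c) * smooth_bump \<sigma>))"
    unfolding sub sum_distrib_left by (intro sum.cong refl mult.left_commute)
  also have "(\<Sum>j=1..M. a j / r j * (LINT \<sigma>|lborel. lam (t0 + \<epsilon> / c * \<sigma> - r j / c) * smooth_bump \<sigma>))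
      = (LINT \<sigma>|lborel. (\<Sum>j=1..M. a j / r j * (lam (t0 + \<epsilon> / c * \<sigma> - r j / c) * smooth_bump \<sigma>)))"
    by (subst Bochner_Integration.integral_sum)
      (intro integrable_mult_right integrable_times_smooth_bump L | simp)+
  also have "\<dots> = (LINT \<sigma>|lborel. retarded_potential c lam M a s x0 (t0 + \<epsilon> / c * \<sigma>) * smooth_bump \<sigma>)"
    by (intro Bochner_Integration.integral_cong refl)
      (auto simp: retarded_potential_def r_def sum_distrib_right intro!: sum.cong)
  finally show ?thesis .
qed

section \<open>The test wave at scale \<epsilon> and the comparison of the potentials\<close>

lemma smooth_cutoff:
  assumes "smooth k" "b \<noteq> 0"
  shows "smooth (\<lambda>\<sigma>. k ((\<sigma> - d) / b :: real) :: real)"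
    and "deriv (\<lambda>\<sigma>. k ((\<sigma> - d) / b)) = (\<lambda>\<sigma>. deriv k ((\<sigma> - d) / b) / b)"
proof -
  show "smooth (\<lambda>\<sigma>. k ((\<sigma> - d) / b))"
    using smooth_affine[OF assms(1), of "1 / b" "- d / b"] by (simp add: diff_divide_distrib)
  show "deriv (\<lambda>\<sigma>. k ((\<sigma> - d) / b)) = (\<lambda>\<sigma>. deriv k ((\<sigma> - d) / b) / b)"
  proof (intro ext DERIV_imp_deriv)
    fix \<sigma>
    have "((\<lambda>\<sigma>. (\<sigma> - d) / b) has_real_derivative 1 / b) (at \<sigma>)"
      using assms(2) by (auto intro!: derivative_eq_intros)
    from DERIV_chain2[OF smooth_has_real_derivative[OF assms(1)] this]
    show "((\<lambda>\<sigma>. k ((\<sigma> - d) / b)) has_real_derivative deriv k ((\<sigma> - d) / b) / b) (at \<sigma>)"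
      by simp
  qed
qed

text \<open>
  The inner cutoff yields the part concentrated at \<open>(x0, t0)\<close>; the outer one, needed for compact
  support, contributes only at negative times, where causal solutions vanish.
\<close>

lemma ex_backward_test_wave:
  fixes x0 :: "real^3"
  assumes "c > 0"
  obtains C K :: real where "C > 0" "K > 0"
    and "\<And>\<epsilon> R. 0 < \<epsilon> \<Longrightarrow> 2 * \<epsilon> < R \<Longrightarrow> c * t0 + \<epsilon> < R \<Longrightarrow>
      \<exists>g. (\<forall>r. 2 * \<epsilon> \<le> r \<and> r \<le> R \<longrightarrow> g r = 1) \<and>
        (let \<Phi> = radial_wave x0 c (\<lambda>r. g r / r) (\<lambda>\<sigma>. smooth_bump ((\<sigma> - c * t0) / \<epsilon>)) in
          test_function \<Phi> \<and>
          (\<forall>z. dalembertian c \<Phi> z = 0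
            \<or> z \<in> cball (x0, t0) (K * \<epsilon>) \<and> \<bar>dalembertian c \<Phi> z\<bar> \<le> C / \<epsilon> ^ 3
            \<or> norm (fst z - x0) \<ge> R \<and> snd z < 0))"
proof -
  let ?k = smooth_step
  let ?b = smooth_bump
  have k: "smooth ?k" "smooth (deriv ?k)" "smooth (deriv (deriv ?k))"
    by (intro smooth_deriv smooth_smooth_step)+
  have b: "smooth ?b" "smooth (deriv ?b)"
    by (intro smooth_deriv smooth_smooth_bump)+
  have k1: "deriv ?k x = 0" if "x < 0 \<or> x > 1" for x
    using deriv_eq_0_open[of "{..<0}" x ?k 0] deriv_eq_0_open[of "{1<..}" x ?k 1] that
    by (auto simp: smooth_step_eq_0 smooth_step_eq_1)
  have k2: "deriv (deriv ?k) x = 0" if "x < 0 \<or> x > 1" for x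
    using deriv_eq_0_open[of "{..<0}" x "deriv ?k" 0] deriv_eq_0_open[of "{1<..}" x "deriv ?k" 0] that k1
    by auto
  have b1: "deriv ?b x = 0" if "x < - 1 \<or> x > 1" for x
    using deriv_eq_0_open[of "{..<-1}" x ?b 0] deriv_eq_0_open[of "{1<..}" x ?b 0] that
    by (auto simp: smooth_bump_eq_0)
  have b0: "?b x = 0" if "x < - 1 \<or> x > 1" for x
    using that by (auto intro: smooth_bump_eq_0)
  obtain K1 where K1: "K1 > 0" "\<And>x. \<bar>deriv ?k x\<bar> \<le> K1"
    using bounded_of_zero_outside[OF smooth_continuous_on[OF k(2)] k1] by blast
  obtain K2 where K2: "K2 > 0" "\<And>x. \<bar>deriv (deriv ?k) x\<bar> \<le> K2"
    using bounded_of_zero_outside[OF smooth_continuous_on[OF k(3)] k2] by blast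
  obtain B1 where B1: "B1 > 0" "\<And>x. \<bar>deriv ?b x\<bar> \<le> B1"
    using bounded_of_zero_outside[OF smooth_continuous_on[OF b(2)] b1] by blast
  obtain B0 where B0: "B0 > 0" "\<And>x. \<bar>?b x\<bar> \<le> B0"
    using bounded_of_zero_outside[OF smooth_continuous_on[OF b(1)] b0] by blast
  \<comment> \<open>Bounds \<open>g'' h + 2 g' h'\<close> after removal of its factor \<epsilon>^-2;
    division by r, which is at least \<epsilon> in the transition layer, gives the third
    power.\<close>
  define C where "C = K2 * B0 + 2 * (K1 * B1)"
  \<comment> \<open>In the layer r is at most 2\<epsilon>; together with
    \<open>\<bar>c t + r - c t0\<bar> \<le> \<epsilon>\<close> this gives
    \<open>\<bar>t - t0\<bar> \<le> 3 * \<epsilon> / c\<close>.\<close>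
  define K where "K = 2 + 3 / c"
  show thesis
  proof (rule that[of C K])
    show "C > 0" "K > 0"
      using K1 K2 B0 B1 assms by (auto simp: C_def K_def intro!: add_pos_pos)
    fix \<epsilon> R :: real
    assume \<epsilon>: "0 < \<epsilon>" "2 * \<epsilon> < R" "c * t0 + \<epsilon> < R"
    \<comment> \<open>The first factor rises from 0 to 1 on [\<epsilon>, 2\<epsilon>], the second
      falls from 1 to 0 on [R, R + 1].\<close>
    define g where "g r = ?k ((r - \<epsilon>) / \<epsilon>) * ?k ((r - (R + 1)) / (- 1))" for r
    define h where "h = (\<lambda>\<sigma>. ?b ((\<sigma> - c * t0) / \<epsilon>))"
    have sg: "smooth g"
      unfolding g_def[abs_def] using \<epsilon> by (intro smooth_mult smooth_cutoff k) auto
    have sh: "smooth h"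
      unfolding h_def using \<epsilon> by (intro smooth_cutoff b) auto
    have g0: "g r = 0" if "r < \<epsilon>" for r
      using that \<epsilon> by (auto simp: g_def divide_nonpos_pos intro!: smooth_step_eq_0)
    have gR: "g r = 0" if "r > R + 1" for r
      using that \<epsilon> by (auto simp: g_def intro!: smooth_step_eq_0)
    have g1: "g r = 1" if "2 * \<epsilon> \<le> r \<and> r \<le> R" for r
      using that \<epsilon> by (auto simp: g_def smooth_step_eq_1 field_simps)
    have gin: "g r = ?k ((r - \<epsilon>) / \<epsilon>)" if "r < R" for r
      using that by (simp add: g_def smooth_step_eq_1)
    have dg: "deriv g r = deriv ?k ((r - \<epsilon>) / \<epsilon>) / \<epsilon>" if "r < R" for r
    proof -
      have "((\<lambda>r. ?k ((r - \<epsilon>) / \<epsilon>)) has_real_derivative deriv ?k ((r - \<epsilon>) / \<epsilon>) / \<epsilon>) (at r)"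
        using smooth_has_real_derivative[OF smooth_cutoff(1)[OF k(1), of \<epsilon> \<epsilon>], of r]
          smooth_cutoff(2)[OF k(1), of \<epsilon> \<epsilon>] \<epsilon> by simp
      from has_field_derivative_transform_within_open[OF this, of "{..<R}" g] that gin
      show ?thesis by (intro DERIV_imp_deriv) auto
    qed
    have ddg: "deriv (deriv g) r = deriv (deriv ?k) ((r - \<epsilon>) / \<epsilon>) / \<epsilon>\<^sup>2" if "r < R" for r
    proof -
      have "((\<lambda>r. deriv ?k ((r - \<epsilon>) / \<epsilon>)) has_real_derivative
          deriv (deriv ?k) ((r - \<epsilon>) / \<epsilon>) / \<epsilon>) (at r)"
        using smooth_has_real_derivative[OF smooth_cutoff(1)[OF k(2), of \<epsilon> \<epsilon>], of r]
          smooth_cutoff(2)[OF k(2), of \<epsilon> \<epsilon>] \<epsilon> by simp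
      from DERIV_cdivide[OF this, of \<epsilon>]
      have "((\<lambda>r. deriv ?k ((r - \<epsilon>) / \<epsilon>) / \<epsilon>) has_real_derivative
          deriv (deriv ?k) ((r - \<epsilon>) / \<epsilon>) / \<epsilon>\<^sup>2) (at r)"
        by (simp add: power2_eq_square)
      from has_field_derivative_transform_within_open[OF this, of "{..<R}" "deriv g"] that dg
      show ?thesis by (intro DERIV_imp_deriv) auto
    qed
    have dh: "deriv h \<sigma> = deriv ?b ((\<sigma> - c * t0) / \<epsilon>) / \<epsilon>" for \<sigma>
      unfolding h_def using smooth_cutoff(2)[OF b(1), of \<epsilon> "c * t0"] \<epsilon> by simp
    have h0: "h \<sigma> = 0 \<and> deriv h \<sigma> = 0" if "\<bar>\<sigma> - c * t0\<bar> > \<epsilon>" for \<sigma>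
    proof -
      have "(\<sigma> - c * t0) / \<epsilon> < - 1 \<or> (\<sigma> - c * t0) / \<epsilon> > 1"
        using that \<epsilon> by (auto simp: field_simps)
      then show ?thesis using b0 b1 unfolding dh by (auto simp: h_def)
    qed
    define \<Phi> where "\<Phi> = radial_wave x0 c (\<lambda>r. g r / r) h"
    have tf: "test_function \<Phi>"
      unfolding \<Phi>_def
    proof (rule test_function_radial_wave[OF assms sg sh \<epsilon>(1) g0 gR])
      show "h s = 0" if "\<bar>s\<bar> > \<epsilon> + \<bar>c * t0\<bar>" for s
        using h0[of s] that by linarith
    qed
    have "dalembertian c \<Phi> z = 0
            \<or> z \<in> cball (x0, t0) (K * \<epsilon>) \<and> \<bar>dalembertian c \<Phi> z\<bar> \<le> C / \<epsilon> ^ 3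
            \<or> norm (fst z - x0) \<ge> R \<and> snd z < 0" for z
    proof (cases "dalembertian c \<Phi> z = 0")
      case False
      define r where "r = norm (fst z - x0)"
      define \<sigma> where "\<sigma> = c * snd z + r"
      have W: "dalembertian c \<Phi> z = - (deriv (deriv g) r * h \<sigma> + 2 * deriv g r * deriv h \<sigma>) / r"
        unfolding \<Phi>_def r_def \<sigma>_def by (rule dalembertian_radial_wave[OF assms sg sh \<epsilon>(1) g0])
      have "\<bar>\<sigma> - c * t0\<bar> \<le> \<epsilon>"
      proof (rule ccontr)
        assume "\<not> \<bar>\<sigma> - c * t0\<bar> \<le> \<epsilon>"
        then have "h \<sigma> = 0 \<and> deriv h \<sigma> = 0" by (intro h0) simp
        then show False using False by (simp add: W)
      qed
      show ?thesis
      proof (cases "r < R")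
        case True
        have "\<not> ((r - \<epsilon>) / \<epsilon> < 0 \<or> (r - \<epsilon>) / \<epsilon> > 1)"
          using False k1 k2 unfolding W dg[OF True] ddg[OF True] by auto
        then have r: "\<epsilon> \<le> r" "r \<le> 2 * \<epsilon>"
          using \<epsilon> by (auto simp: field_simps)
        have "\<bar>c * (snd z - t0)\<bar> \<le> 3 * \<epsilon>"
          using \<open>\<bar>\<sigma> - c * t0\<bar> \<le> \<epsilon>\<close> r \<epsilon>(1) unfolding \<sigma>_def right_diff_distrib by linarith
        then have "\<bar>snd z - t0\<bar> \<le> 3 / c * \<epsilon>"
          using assms unfolding abs_mult by (simp add: pos_le_divide_eq mult.commute)
        moreover have "dist (x0, t0) z \<le> norm (fst z - x0) + \<bar>snd z - t0\<bar>"
          using norm_Pair_le[of "x0 - fst z" "t0 - snd z"]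
          by (cases z) (simp add: dist_norm norm_minus_commute abs_minus_commute)
        ultimately have "z \<in> cball (x0, t0) (K * \<epsilon>)"
          using r(2) by (simp add: K_def r_def algebra_simps)
        moreover have "\<bar>dalembertian c \<Phi> z\<bar> \<le> C / \<epsilon> ^ 3"
        proof -
          let ?y = "(r - \<epsilon>) / \<epsilon>" and ?w = "(\<sigma> - c * t0) / \<epsilon>"
          have "dalembertian c \<Phi> z
              = - ((deriv (deriv ?k) ?y * ?b ?w + 2 * (deriv ?k ?y * deriv ?b ?w)) / (\<epsilon>\<^sup>2 * r))"
            unfolding W dg[OF True] ddg[OF True] dh unfolding h_def using \<epsilon> by (simp add: power2_eq_square field_simps)
          also have "\<bar>\<dots>\<bar> = \<bar>deriv (deriv ?k) ?y * ?b ?w + 2 * (deriv ?k ?y * deriv ?b ?w)\<bar> / (\<epsilon>\<^sup>2 * r)"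
            using r \<epsilon> by (simp add: abs_mult)
          also have "\<dots> \<le> C / (\<epsilon>\<^sup>2 * \<epsilon>)"
          proof (rule frac_le)
            have "\<bar>deriv (deriv ?k) ?y * ?b ?w\<bar> \<le> K2 * B0" "\<bar>deriv ?k ?y * deriv ?b ?w\<bar> \<le> K1 * B1"
              unfolding abs_mult
              by (intro mult_mono abs_ge_zero less_imp_le[OF K1(1)] less_imp_le[OF K2(1)]
                  K1(2) K2(2) B0(2) B1(2))+
            then show "\<bar>deriv (deriv ?k) ?y * ?b ?w + 2 * (deriv ?k ?y * deriv ?b ?w)\<bar> \<le> C"
              unfolding C_def by linarith
          qed (use r \<epsilon> \<open>C > 0\<close> in auto)
          finally show ?thesis by (simp add: power3_eq_cube power2_eq_square)
        qed
        ultimately show ?thesis by blast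
      next
        case False
        \<comment> \<open>Here \<open>c t + r \<le> c t0 + \<epsilon> < R \<le> r\<close>.\<close>
        then have "c * snd z < 0"
          using \<open>\<bar>\<sigma> - c * t0\<bar> \<le> \<epsilon>\<close> \<epsilon> unfolding \<sigma>_def by linarith
        then show ?thesis
          using False assms by (auto simp: r_def mult_less_0_iff)
      qed
    qed simp
    with tf g1 show "\<exists>g. (\<forall>r. 2 * \<epsilon> \<le> r \<and> r \<le> R \<longrightarrow> g r = 1) \<and>
        (let \<Phi> = radial_wave x0 c (\<lambda>r. g r / r) (\<lambda>\<sigma>. smooth_bump ((\<sigma> - c * t0) / \<epsilon>)) in
          test_function \<Phi> \<and>
          (\<forall>z. dalembertian c \<Phi> z = 0
            \<or> z \<in> cball (x0, t0) (K * \<epsilon>) \<and> \<bar>dalembertian c \<Phi> z\<bar> \<le> C / \<epsilon> ^ 3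
            \<or> norm (fst z - x0) \<ge> R \<and> snd z < 0))"
      unfolding \<Phi>_def h_def Let_def by blast
  qed
qed

text \<open>
  Since \<open>u1 = u2\<close> at \<open>x0\<close>, the difference \<open>u1 - u2\<close> is small near \<open>(x0, t0)\<close>, so integrated against the
  d'Alembertian of the test function of scale \<open>\<epsilon>\<close> it gives \<open>o(\<epsilon>)\<close>, whereas the sources give \<open>\<epsilon>\<close> times
  the difference of the retarded potentials.
\<close>

lemma retarded_potential_eq:
  assumes "c > 0"
    and lam: "continuous_on UNIV lam1" "continuous_on UNIV lam2"
    and u1: "causal_wave_solution c (point_sources lam1 M1 a1 s1) (s1 ` {1..M1}) u1"
    and u2: "causal_wave_solution c (point_sources lam2 M2 a2 s2) (s2 ` {1..M2}) u2"
    and x0: "x0 \<notin> s1 ` {1..M1}" "x0 \<notin> s2 ` {1..M2}"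
    and eq: "\<And>t. u1 x0 t = u2 x0 t"
  shows "retarded_potential c lam1 M1 a1 s1 x0 t0 = retarded_potential c lam2 M2 a2 s2 x0 t0"
proof -
  define S where "S = s1 ` {1..M1} \<union> s2 ` {1..M2}"
  have S: "finite S" "x0 \<notin> S" using x0 by (auto simp: S_def)
  define D where "D t = retarded_potential c lam1 M1 a1 s1 x0 t - retarded_potential c lam2 M2 a2 s2 x0 t" for t
  have contD: "continuous_on A D" for A
    unfolding D_def[abs_def] using lam by (intro continuous_intros continuous_on_retarded_potential)
  define w :: "spacetime \<Rightarrow> real"
    where "w = (\<lambda>z. (case z of (x, t) \<Rightarrow> u1 x t) - (case z of (x, t) \<Rightarrow> u2 x t))"
  have oS: "open ((- S) \<times> (UNIV :: real set))"
    using S(1) by (intro open_Times) (auto simp: finite_imp_closed)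
  have "continuous_on ((- S) \<times> UNIV) w"
    unfolding w_def using u1 u2
    by (intro continuous_on_diff; unfold causal_wave_solution_def)
      (auto elim!: continuous_on_subset simp: S_def)
  then have contw: "isCont w (x0, t0)"
    using oS S(2) by (simp add: continuous_on_eq_continuous_at)
  have w0: "w (x0, t0) = 0" by (simp add: w_def eq)
  have wneg: "w z = 0" if "fst z \<notin> S" "snd z < 0" for z
    using u1 u2 that by (cases z) (auto simp: w_def causal_wave_solution_def causal_def S_def)
  obtain C K where CK: "C > 0" "K > 0"
    and test: "\<And>\<epsilon> R. 0 < \<epsilon> \<Longrightarrow> 2 * \<epsilon> < R \<Longrightarrow> c * t0 + \<epsilon> < R \<Longrightarrow>
      \<exists>g. (\<forall>r. 2 * \<epsilon> \<le> r \<and> r \<le> R \<longrightarrow> g r = 1) \<and>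
        (let \<Phi> = radial_wave x0 c (\<lambda>r. g r / r) (\<lambda>\<sigma>. smooth_bump ((\<sigma> - c * t0) / \<epsilon>)) in
          test_function \<Phi> \<and>
          (\<forall>z. dalembertian c \<Phi> z = 0
            \<or> z \<in> cball (x0, t0) (K * \<epsilon>) \<and> \<bar>dalembertian c \<Phi> z\<bar> \<le> C / \<epsilon> ^ 3
            \<or> norm (fst z - x0) \<ge> R \<and> snd z < 0))"
    by (rule ex_backward_test_wave[OF assms(1), where ?x0.0 = x0 and ?t0.0 = t0]) (rule that; assumption)
  define V where "V = unit_ball_vol 4"
  \<comment> \<open>Chosen so that \<open>C / \<epsilon> ^ 3\<close> times the volume
    \<open>V * (K * \<epsilon>) ^ 4\<close> of the four-dimensional ball is
    \<open>\<epsilon> / c * C'\<close>, with the same prefactor as the source terms.\<close>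
  define C' where "C' = c * (C * V * K ^ 4)"
  define H where "H = (LINT \<sigma>|lborel. smooth_bump \<sigma>)"
  have H: "H > 0"
  proof -
    have I: "integrable lborel smooth_bump"
      using integrable_times_smooth_bump[of "\<lambda>_. 1"] by simp
    have "H \<ge> 0" unfolding H_def by (intro integral_nonneg_AE) (simp add: smooth_bump_nonneg)
    \<comment> \<open>A nonnegative function with integral 0 vanishes almost everywhere, but the
      bump is nonzero on a nonempty open set.\<close>
    moreover have "H \<noteq> 0"
    proof
      assume "H = 0"
      then have "AE \<sigma> in lborel. smooth_bump \<sigma> = 0"
        unfolding H_def using integral_nonneg_eq_0_iff_AE[OF I] by (simp add: smooth_bump_nonneg)
      moreover have o: "open {\<sigma>. smooth_bump \<sigma> \<noteq> 0}"
        by (intro open_Collect_neq smooth_continuous_on smooth_smooth_bump continuous_intros)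
      ultimately have "{\<sigma>. smooth_bump \<sigma> \<noteq> 0} \<in> null_sets lborel"
        by (subst (asm) AE_iff_null) auto
      then have "negligible {\<sigma>. smooth_bump \<sigma> \<noteq> 0}"
        by (simp add: negligible_iff_null_sets null_sets_completionI)
      moreover have "0 \<in> {\<sigma>. smooth_bump \<sigma> \<noteq> 0}"
        using smooth_bump_0 by simp
      ultimately show False using o open_not_negligible by blast
    qed
    ultimately show ?thesis by simp
  qed
  \<comment> \<open>\<open>\<eta>\<close> bounds both \<open>w\<close> on the ball and the
    oscillation of \<open>D\<close> on the averaging window; \<open>C'\<close> and \<open>H\<close>
    do not depend on it.\<close>
  have bound: "\<bar>D t0\<bar> * H \<le> \<eta> * (C' + H)" if "\<eta> > 0" for \<eta>
  proof -
    obtain \<delta> where \<delta>: "\<delta> > 0" "\<And>z. dist z (x0, t0) < \<delta> \<Longrightarrow> \<bar>w z\<bar> < \<eta>"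
      using contw \<open>\<eta> > 0\<close> unfolding continuous_at_eps_delta w0 by (auto simp: dist_real_def)
    have "isCont D t0" using contD[of UNIV] by (simp add: continuous_on_eq_continuous_at)
    then obtain \<delta>' where \<delta>': "\<delta>' > 0" "\<And>t. dist t t0 < \<delta>' \<Longrightarrow> \<bar>D t - D t0\<bar> < \<eta>"
      using \<open>\<eta> > 0\<close> unfolding continuous_at_eps_delta by (auto simp: dist_real_def)
    obtain d where d: "d > 0" "\<And>p. p \<in> S \<Longrightarrow> d \<le> norm (p - x0)"
      using finite_set_avoid[OF S(1), of x0] S(2) by (metis dist_commute dist_norm)
    obtain R0 where R0: "\<And>p. p \<in> S \<Longrightarrow> norm (p - x0) \<le> R0"
    proof -
      have "bounded ((\<lambda>p. p - x0) ` S)" using S(1) by (intro finite_imp_bounded) auto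
      then show ?thesis using that by (auto simp: bounded_iff)
    qed
    \<comment> \<open>In this order the bounds give: \<open>2 * \<epsilon> < R\<close>; the ball of
      radius \<open>K * \<epsilon>\<close> lies where \<open>w\<close> is small; the window of
      length \<open>\<epsilon> / c\<close> lies where \<open>D\<close> is nearly constant; all
      sources are at distance at least \<open>2 * \<epsilon>\<close> from \<open>x0\<close>, where
      \<open>g\<close> is already 1.\<close>
    define \<epsilon> where "\<epsilon> = Min {1, \<delta> / (2 * K), \<delta>' * c / 2, d / 2}"
    have \<epsilon>: "\<epsilon> > 0" "\<epsilon> \<le> 1" "\<epsilon> \<le> \<delta> / (2 * K)" "\<epsilon> \<le> \<delta>' * c / 2" "\<epsilon> \<le> d / 2"
      using CK \<delta> \<delta>' d assms(1) by (auto simp: \<epsilon>_def)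
    \<comment> \<open>\<open>R0 + 1\<close> keeps the sources out of the outer cutoff region; the
      other bound exceeds \<open>2 * \<epsilon>\<close> and
      \<open>c * t0 + \<epsilon>\<close>.\<close>
    define R where "R = max (R0 + 1) (\<bar>c * t0\<bar> + 3)"
    have R: "2 * \<epsilon> < R" "c * t0 + \<epsilon> < R" "R0 < R"
      using \<epsilon>(2) by (auto simp: R_def)
    obtain g where g: "\<And>r. 2 * \<epsilon> \<le> r \<and> r \<le> R \<Longrightarrow> g r = 1"
      and g': "let \<Phi> = radial_wave x0 c (\<lambda>r. g r / r) (\<lambda>\<sigma>. smooth_bump ((\<sigma> - c * t0) / \<epsilon>)) in
          test_function \<Phi> \<and>
          (\<forall>z. dalembertian c \<Phi> z = 0
            \<or> z \<in> cball (x0, t0) (K * \<epsilon>) \<and> \<bar>dalembertian c \<Phi> z\<bar> \<le> C / \<epsilon> ^ 3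
            \<or> norm (fst z - x0) \<ge> R \<and> snd z < 0)"
      using test[OF \<epsilon>(1) R(1,2)] by blast
    define \<Phi> where "\<Phi> = radial_wave x0 c (\<lambda>r. g r / r) (\<lambda>\<sigma>. smooth_bump ((\<sigma> - c * t0) / \<epsilon>))"
    have \<Phi>: "test_function \<Phi>"
      and \<Phi>_cases: "\<And>z. dalembertian c \<Phi> z = 0
            \<or> z \<in> cball (x0, t0) (K * \<epsilon>) \<and> \<bar>dalembertian c \<Phi> z\<bar> \<le> C / \<epsilon> ^ 3
            \<or> norm (fst z - x0) \<ge> R \<and> snd z < 0"
      using g' unfolding \<Phi>_def Let_def by blast+
    have gS: "g (norm (x0 - p)) = 1" if "p \<in> S" for p
      using d(2)[OF that] R0[OF that] \<epsilon>(5) R(3) by (intro g) (auto simp: norm_minus_commute)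
    have "\<bar>w z * dalembertian c \<Phi> z\<bar> \<le> (\<eta> * (C / \<epsilon> ^ 3)) * indicator (cball (x0, t0) (K * \<epsilon>)) z" for z
      using \<Phi>_cases[of z]
    proof (elim disjE)
      assume z: "z \<in> cball (x0, t0) (K * \<epsilon>) \<and> \<bar>dalembertian c \<Phi> z\<bar> \<le> C / \<epsilon> ^ 3"
      have "K * \<epsilon> \<le> \<delta> / 2" using \<epsilon>(3) CK(2) by (simp add: field_simps)
      then have "dist z (x0, t0) < \<delta>" using z \<delta>(1) by (simp add: dist_commute)
      then have "\<bar>w z\<bar> \<le> \<eta>" using \<delta>(2) less_imp_le by blast
      then have "\<bar>w z\<bar> * \<bar>dalembertian c \<Phi> z\<bar> \<le> \<eta> * (C / \<epsilon> ^ 3)"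
        using z \<open>\<eta> > 0\<close> by (intro mult_mono) auto
      then show ?thesis
        using z by (simp add: abs_mult)
    next
      \<comment> \<open>Beyond \<open>R\<close> there are no sources, so causality gives
        \<open>w = 0\<close> at negative times.\<close>
      assume z: "norm (fst z - x0) \<ge> R \<and> snd z < 0"
      then have "fst z \<notin> S" using R0[of "fst z"] R(3) by auto
      then show ?thesis
        using wneg[of z] z \<open>\<eta> > 0\<close> CK \<epsilon>(1) by (auto simp: indicator_def)
    next
      assume "dalembertian c \<Phi> z = 0"
      then show ?thesis using \<open>\<eta> > 0\<close> CK \<epsilon>(1) by (auto simp: indicator_def)
    qed
    note pointwise = this
    have i1: "integrable lebesgue (\<lambda>z. (case z of (x, t) \<Rightarrow> u1 x t) * dalembertian c \<Phi> z)"
      and e1: "wave_op c (distr_of u1) \<Phi> = (LINT z|lebesgue. (case z of (x, t) \<Rightarrow> u1 x t) * dalembertian c \<Phi> z)"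
      using u1 by (auto simp: causal_wave_solution_def intro!: wave_op_distr_of[OF \<Phi>] simp del: split_paired_All)
    have i2: "integrable lebesgue (\<lambda>z. (case z of (x, t) \<Rightarrow> u2 x t) * dalembertian c \<Phi> z)"
      and e2: "wave_op c (distr_of u2) \<Phi> = (LINT z|lebesgue. (case z of (x, t) \<Rightarrow> u2 x t) * dalembertian c \<Phi> z)"
      using u2 by (auto simp: causal_wave_solution_def intro!: wave_op_distr_of[OF \<Phi>] simp del: split_paired_All)
    have iw: "integrable lebesgue (\<lambda>z. w z * dalembertian c \<Phi> z)"
      unfolding w_def left_diff_distrib by (intro Bochner_Integration.integrable_diff i1 i2)
    have "(LINT z|lebesgue. w z * dalembertian c \<Phi> z)
        = wave_op c (distr_of u1) \<Phi> - wave_op c (distr_of u2) \<Phi>"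
      unfolding w_def left_diff_distrib e1 e2 by (rule Bochner_Integration.integral_diff[OF i1 i2])
    also have "\<dots> = point_sources lam1 M1 a1 s1 \<Phi> - point_sources lam2 M2 a2 s2 \<Phi>"
      using u1 u2 \<Phi> by (simp add: causal_wave_solution_def)
    also have "point_sources lam1 M1 a1 s1 \<Phi> = \<epsilon> / c *
        (LINT \<sigma>|lborel. retarded_potential c lam1 M1 a1 s1 x0 (t0 + \<epsilon> / c * \<sigma>) * smooth_bump \<sigma>)"
      unfolding \<Phi>_def by (rule point_sources_radial_wave[OF assms(1) \<epsilon>(1) lam(1)]) (auto intro!: gS simp: S_def)
    also have "point_sources lam2 M2 a2 s2 \<Phi> = \<epsilon> / c *
        (LINT \<sigma>|lborel. retarded_potential c lam2 M2 a2 s2 x0 (t0 + \<epsilon> / c * \<sigma>) * smooth_bump \<sigma>)"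
      unfolding \<Phi>_def by (rule point_sources_radial_wave[OF assms(1) \<epsilon>(1) lam(2)]) (auto intro!: gS simp: S_def)
    also have "\<epsilon> / c * (LINT \<sigma>|lborel. retarded_potential c lam1 M1 a1 s1 x0 (t0 + \<epsilon> / c * \<sigma>) * smooth_bump \<sigma>)
        - \<epsilon> / c * (LINT \<sigma>|lborel. retarded_potential c lam2 M2 a2 s2 x0 (t0 + \<epsilon> / c * \<sigma>) * smooth_bump \<sigma>)
        = \<epsilon> / c * (LINT \<sigma>|lborel. D (t0 + \<epsilon> / c * \<sigma>) * smooth_bump \<sigma>)"
    proof -
      have "continuous_on UNIV (\<lambda>\<sigma>. retarded_potential c lam M a s x0 (t0 + \<epsilon> / c * \<sigma>))"
        if "continuous_on UNIV lam" for lam M a and s :: "nat \<Rightarrow> real^3"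
        by (intro continuous_on_compose2[OF continuous_on_retarded_potential[OF that, of UNIV]])
          (use assms(1) in \<open>auto intro!: continuous_intros\<close>)
      then show ?thesis
        unfolding D_def left_diff_distrib
        by (subst Bochner_Integration.integral_diff)
          (auto intro!: integrable_times_smooth_bump lam simp: right_diff_distrib)
    qed
    finally have main: "(LINT z|lebesgue. w z * dalembertian c \<Phi> z)
        = \<epsilon> / c * (LINT \<sigma>|lborel. D (t0 + \<epsilon> / c * \<sigma>) * smooth_bump \<sigma>)" .
    have "\<bar>LINT z|lebesgue. w z * dalembertian c \<Phi> z\<bar> \<le> \<eta> * (C / \<epsilon> ^ 3) * (V * (K * \<epsilon>) ^ 4)"
    proof -
      let ?B = "cball (x0, t0) (K * \<epsilon>)"
      have m: "measure lebesgue ?B = V * (K * \<epsilon>) ^ 4"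
        using content_cball[of "K * \<epsilon>" "(x0, t0)"] CK(2) \<epsilon>(1) by (simp add: V_def)
      have ib: "integrable lebesgue (\<lambda>z. (\<eta> * (C / \<epsilon> ^ 3)) * indicat_real ?B z)"
        by (intro integrable_mult_right integrable_real_indicator)
          (auto simp: emeasure_cball CK(2) \<epsilon>(1) less_imp_le)
      have "\<bar>LINT z|lebesgue. w z * dalembertian c \<Phi> z\<bar>
          \<le> (LINT z|lebesgue. (\<eta> * (C / \<epsilon> ^ 3)) * indicat_real ?B z)"
        using Bochner_Integration.integral_norm_bound_integral[OF iw ib] pointwise by simp
      also have "\<dots> = \<eta> * (C / \<epsilon> ^ 3) * measure lebesgue ?B"
        by simp
      finally show ?thesis unfolding m .
    qed
    also have "\<dots> = \<epsilon> / c * (\<eta> * C')"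
      using \<epsilon>(1) assms(1) by (simp add: C'_def power_mult_distrib field_simps eval_nat_numeral)
    finally have est: "\<bar>LINT \<sigma>|lborel. D (t0 + \<epsilon> / c * \<sigma>) * smooth_bump \<sigma>\<bar> \<le> \<eta> * C'"
      unfolding main abs_mult using \<epsilon>(1) assms(1)
      by (simp del: times_divide_eq_left add: mult_le_cancel_left)
    have cD: "continuous_on UNIV (\<lambda>\<sigma>. D (t0 + \<epsilon> / c * \<sigma>))"
      by (intro continuous_on_compose2[OF contD[of UNIV]])
        (use assms(1) in \<open>auto intro!: continuous_intros\<close>)
    have "(LINT \<sigma>|lborel. D (t0 + \<epsilon> / c * \<sigma>) * smooth_bump \<sigma>) - D t0 * H
        = (LINT \<sigma>|lborel. (D (t0 + \<epsilon> / c * \<sigma>) - D t0) * smooth_bump \<sigma>)"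
      unfolding left_diff_distrib H_def Bochner_Integration.integral_diff[OF
          integrable_times_smooth_bump[OF cD] integrable_times_smooth_bump[OF continuous_on_const]]
      by simp
    also have "\<bar>\<dots>\<bar> \<le> (LINT \<sigma>|lborel. \<eta> * smooth_bump \<sigma>)"
    proof -
      have p: "\<bar>(D (t0 + \<epsilon> / c * \<sigma>) - D t0) * smooth_bump \<sigma>\<bar> \<le> \<eta> * smooth_bump \<sigma>" for \<sigma>
      proof (cases "\<bar>\<sigma>\<bar> \<ge> 1")
        case True
        then show ?thesis by (simp add: smooth_bump_eq_0)
      next
        case False
        have "\<epsilon> / c * \<bar>\<sigma>\<bar> \<le> \<epsilon> / c * 1"
          using False \<epsilon>(1) assms(1) by (intro mult_left_mono) auto
        also have "\<dots> < \<delta>'"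
          using \<epsilon>(4) \<delta>'(1) assms(1) by (simp add: field_simps) (smt (verit) mult_pos_pos)
        finally have "dist (t0 + \<epsilon> / c * \<sigma>) t0 < \<delta>'"
          using \<epsilon>(1) assms(1) by (simp add: dist_real_def abs_mult)
        then show ?thesis
          using \<delta>'(2) smooth_bump_nonneg[of \<sigma>]
          by (simp add: abs_mult mult_right_mono less_imp_le)
      qed
      have "integrable lborel (\<lambda>\<sigma>. (D (t0 + \<epsilon> / c * \<sigma>) - D t0) * smooth_bump \<sigma>)"
        "integrable lborel (\<lambda>\<sigma>. \<eta> * smooth_bump \<sigma>)"
        by (intro integrable_times_smooth_bump cD continuous_on_diff continuous_on_const)+
      from Bochner_Integration.integral_norm_bound_integral[OF this] p show ?thesis
        unfolding real_norm_def by blast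
    qed
    also have "\<dots> = \<eta> * H" by (simp add: H_def)
    finally have "\<bar>D t0 * H\<bar> \<le> \<eta> * C' + \<eta> * H"
      using est by linarith
    then show ?thesis using H by (simp add: abs_mult distrib_left)
  qed
  have "C' > 0"
    unfolding C'_def V_def using CK assms(1) by (intro mult_pos_pos) auto
  have "D t0 = 0"
  proof (rule ccontr)
    assume "D t0 \<noteq> 0"
    then have "\<bar>D t0\<bar> * H > 0" using H by simp
    \<comment> \<open>For this \<open>\<eta>\<close> the bound is half of the left-hand side, which
      is positive.\<close>
    moreover from this have "\<bar>D t0\<bar> * H \<le> \<bar>D t0\<bar> * H / (2 * (C' + H)) * (C' + H)"
      using H \<open>C' > 0\<close> by (intro bound divide_pos_pos) auto
    moreover have "x / (2 * p) * p = x / 2" if "p \<noteq> 0" for x p :: real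
      using that by simp
    ultimately show False
      using H \<open>C' > 0\<close> by (smt (verit) field_sum_of_halves)
  qed
  then show ?thesis by (simp add: D_def)
qed

subsection \<open>First arrivals\<close>

text \<open>A functional \<open>v\<close> equal at \<open>p\<close> and \<open>q\<close> but
  different at \<open>y\<close> certifies that \<open>y\<close> is off their line; a nonzero one
  exists from dimension 2 on. The finitely many hyperplanes to be avoided form a null set, while the
  complement of the closure is open and nonempty.\<close>

lemma exists_outside_avoiding_lines:
  fixes \<Omega> :: "'a::euclidean_space set"
  assumes "bounded \<Omega>" "finite P" "DIM('a) \<ge> 2"
  obtains y where "y \<notin> closure \<Omega>"
    "\<And>p q. p \<in> P \<Longrightarrow> q \<in> P \<Longrightarrow> p \<noteq> q \<Longrightarrow> \<exists>v. v \<bullet> p = v \<bullet> q \<and> v \<bullet> y \<noteq> v \<bullet> p"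
proof -
  have "\<exists>v. v \<noteq> 0 \<and> v \<bullet> p = v \<bullet> q" for p q :: 'a
  proof -
    obtain v where "v \<noteq> 0" "orthogonal (p - q) v"
      using orthogonal_to_vector_exists[OF assms(3)] by metis
    then show ?thesis
      by (metis eq_iff_diff_eq_0 inner_commute inner_diff_right orthogonal_def)
  qed
  then obtain v where v: "v p q \<noteq> 0" "v p q \<bullet> p = v p q \<bullet> q" for p q :: 'a
    by metis
  define N where "N = (\<Union>(p, q)\<in>P \<times> P. {y. v p q \<bullet> y = v p q \<bullet> p})"
  have "negligible N"
    unfolding N_def using assms(2) v(1)
    by (intro negligible_Union) (auto intro!: negligible_hyperplane)
  moreover have "\<not> negligible (- closure \<Omega>)"
  proof (rule open_not_negligible)
    have "closure \<Omega> \<noteq> UNIV"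
      using assms(1) bounded_closure[of \<Omega>] not_bounded_UNIV by metis
    then show "- closure \<Omega> \<noteq> {}" by auto
  qed auto
  ultimately obtain y where "y \<in> - closure \<Omega>" "y \<notin> N"
    using negligible_subset by blast
  show ?thesis
  proof (rule that)
    show "y \<notin> closure \<Omega>"
      using \<open>y \<in> - closure \<Omega>\<close> by simp
    show "\<exists>v. v \<bullet> p = v \<bullet> q \<and> v \<bullet> y \<noteq> v \<bullet> p" if "p \<in> P" "q \<in> P" for p q
    proof -
      have "v p q \<bullet> y \<noteq> v p q \<bullet> p"
        using \<open>y \<notin> N\<close> that by (auto simp: N_def)
      then show ?thesis using v(2) by blast
    qed
  qed
qed

text \<open>
  Seen from a point \<open>y\<close> outside \<open>\<Omega>\<close> and off all lines through two sources, let the wave from \<open>p\<close>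
  arrive first. Where the segment from \<open>p\<close> to \<open>y\<close> crosses the boundary, this wave arrives strictly
  before all others: moving towards \<open>p\<close> shortens no other distance as fast.
\<close>

lemma spherical_waves_eq_0:
  fixes \<mu> :: "'a::euclidean_space \<Rightarrow> real \<Rightarrow> real"
  assumes "DIM('a) \<ge> 2" "c > 0" "bounded \<Omega>" "open \<Omega>" "finite P" "P \<subseteq> \<Omega>"
    and causal: "\<And>p. p \<in> P \<Longrightarrow> causal (\<mu> p)"
    and zero: "\<And>x t. x \<in> frontier \<Omega> \<Longrightarrow> (\<Sum>p\<in>P. \<mu> p (t - norm (x - p) / c) / norm (x - p)) = 0"
    and "p \<in> P"
  shows "\<mu> p t = 0"
proof (rule ccontr)
  assume nz: "\<mu> p t \<noteq> 0"
  define P' where "P' = {p \<in> P. \<exists>t. \<mu> p t \<noteq> 0}"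
  \<comment> \<open>Onset of the signal of \<open>p\<close>. For \<open>p\<close> in
    \<open>P'\<close> the set is nonempty, and causality bounds it below, so \<open>Inf\<close> is
    genuine.\<close>
  define T where "T p = Inf {t. \<mu> p t \<noteq> 0}" for p
  have P': "finite P'" "P' \<noteq> {}" "P' \<subseteq> P"
    using assms nz by (auto simp: P'_def)
  have bdd: "bdd_below {t. \<mu> p t \<noteq> 0}" if "p \<in> P'" for p
  proof (rule bdd_belowI[of _ 0])
    show "0 \<le> t" if "t \<in> {t. \<mu> p t \<noteq> 0}" for t
      using causal[of p] that \<open>p \<in> P'\<close> P'(3) by (force simp: causal_def not_le[symmetric])
  qed
  have before: "\<mu> p t = 0" if "p \<in> P'" "t < T p" for p t
    using cInf_lower[OF _ bdd[OF that(1)], of t] that(2) by (force simp: T_def)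
  have after: "\<exists>t. t < T p + e \<and> \<mu> p t \<noteq> 0" if "p \<in> P'" "e > 0" for p e
    using cInf_lessD[of "{t. \<mu> p t \<noteq> 0}" "T p + e"] that by (auto simp: T_def P'_def)
  obtain y where y: "y \<notin> closure \<Omega>"
    "\<And>p q. p \<in> P \<Longrightarrow> q \<in> P \<Longrightarrow> p \<noteq> q \<Longrightarrow> \<exists>v. v \<bullet> p = v \<bullet> q \<and> v \<bullet> y \<noteq> v \<bullet> p"
    using exists_outside_avoiding_lines[OF assms(3,5,1)] by blast
  define p where "p = arg_min_on (\<lambda>p. T p + norm (y - p) / c) P'"
  have p: "p \<in> P'" "\<And>q. q \<in> P' \<Longrightarrow> T p + norm (y - p) / c \<le> T q + norm (y - q) / c"
    unfolding p_def using P'(1,2) by (auto intro: arg_min_if_finite(1) arg_min_least)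
  have "p \<in> \<Omega>" using p(1) P'(3) assms(6) by auto
  have "y \<notin> \<Omega>" using y(1) closure_subset by auto
  then have "closed_segment p y \<inter> frontier \<Omega> \<noteq> {}"
    using \<open>p \<in> \<Omega>\<close> by (intro connected_Int_frontier) auto
  then obtain x where x: "x \<in> frontier \<Omega>" "x \<in> closed_segment p y"
    by blast
  have "x \<noteq> y" using x(1) y(1) by (auto simp: frontier_def)
  obtain r where r: "x = (1 - r) *\<^sub>R p + r *\<^sub>R y" "0 \<le> r" "r \<le> 1"
    using x(2) by (auto simp: closed_segment_def)
  have "x \<noteq> p"
    using x(1) \<open>p \<in> \<Omega>\<close> assms(4) by (auto simp: frontier_def interior_open)
  have yp: "norm (y - p) = norm (y - x) + norm (x - p)"
  proof -
    have "between (y, p) x"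
      using x(2) by (simp add: between_mem_segment closed_segment_commute)
    then show ?thesis by (simp add: between dist_norm)
  qed
  have first: "T p + norm (x - p) / c < T q + norm (x - q) / c" if q: "q \<in> P'" "q \<noteq> p" for q
  proof -
    \<comment> \<open>Equality would put \<open>x\<close> on the segment from \<open>q\<close> to
      \<open>y\<close> as well. The functional \<open>v\<close> then forces equal parameters on both
      segments, hence \<open>p = q\<close> or \<open>x = y\<close>.\<close>
    have "norm (y - q) \<noteq> norm (y - x) + norm (x - q)"
    proof
      assume "norm (y - q) = norm (y - x) + norm (x - q)"
      then have "between (y, q) x"
        by (simp add: between dist_norm)
      then have "x \<in> closed_segment q y"
        by (simp add: between_mem_segment closed_segment_commute)
      then obtain s where s: "x = (1 - s) *\<^sub>R q + s *\<^sub>R y"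
        by (auto simp: closed_segment_def)
      obtain v where v: "v \<bullet> p = v \<bullet> q" "v \<bullet> y \<noteq> v \<bullet> p"
        using y(2)[of p q] p(1) q P'(3) by blast
      have "v \<bullet> x = (1 - r) * (v \<bullet> p) + r * (v \<bullet> y)" "v \<bullet> x = (1 - s) * (v \<bullet> p) + s * (v \<bullet> y)"
        unfolding r(1) using v(1) arg_cong[OF s[unfolded r(1)], of "\<lambda>z. v \<bullet> z"]
        by (simp_all add: inner_add_right)
      then have "(r - s) * (v \<bullet> y - v \<bullet> p) = 0"
        by (simp add: algebra_simps)
      then have "r = s" using v(2) by simp
      then have "(1 - r) *\<^sub>R p = (1 - r) *\<^sub>R q"
        using r(1) s by (metis add_right_cancel)
      then have "r = 1" using q(2) by simp
      then show False using r(1) \<open>x \<noteq> y\<close> by simp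
    qed
    then have "norm (y - q) < norm (y - x) + norm (x - q)"
      using norm_triangle_ineq[of "y - x" "x - q"] by simp
    then have "norm (y - q) / c < norm (y - x) / c + norm (x - q) / c"
      using assms(2) by (simp add: add_divide_distrib[symmetric] divide_strict_right_mono)
    moreover have "norm (y - p) / c = norm (y - x) / c + norm (x - p) / c"
      using yp by (simp add: add_divide_distrib)
    ultimately show ?thesis using p(2)[OF q(1)] by linarith
  qed
  define A where "A q = T q + norm (x - q) / c" for q
  \<comment> \<open>The lead of \<open>p\<close> over the other arrivals at \<open>x\<close>; the
    inserted 1 covers the case that \<open>p\<close> is alone.\<close>
  define e where "e = Min (insert 1 ((\<lambda>q. A q - A p) ` (P' - {p})))"
  have "e > 0"
    unfolding e_def using P'(1) first by (subst Min_gr_iff) (auto simp: A_def)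
  have e: "e \<le> A q - A p" if "q \<in> P'" "q \<noteq> p" for q
    unfolding e_def using P'(1) that by (intro Min_le) auto
  obtain t where t: "t < T p + e" "\<mu> p t \<noteq> 0"
    using after[OF p(1) \<open>e > 0\<close>] by blast
  \<comment> \<open>At \<open>x\<close> and time \<open>t + norm (x - p) / c\<close> the signal of
    \<open>p\<close> is already nonzero, while this time is still before \<open>A p + e\<close>, so
    no other wave has arrived.\<close>
  have "\<mu> q (t + norm (x - p) / c - norm (x - q) / c) = 0" if "q \<in> P - {p}" for q
  proof (cases "q \<in> P'")
    case True
    then show ?thesis
      using e[of q] t(1) that by (intro before) (auto simp: A_def)
  next
    case False
    then show ?thesis using that by (auto simp: P'_def)
  qed
  then have "(\<Sum>q\<in>P. \<mu> q (t + norm (x - p) / c - norm (x - q) / c) / norm (x - q))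
      = \<mu> p t / norm (x - p)"
    using assms(5) p(1) P'(3) by (subst sum.remove[of _ p]) auto
  then show False
    using zero[OF x(1), of "t + norm (x - p) / c"] t(2) \<open>x \<noteq> p\<close> by simp
qed

section \<open>Matching the two families of sources\<close>

lemma sum_if_eq_inj_on:
  fixes f :: "nat \<Rightarrow> real"
  assumes "inj_on s {1..M}" "j \<in> {1..M}"
  shows "(\<Sum>i=1..M. if s i = s j then f i else 0) = f j"
proof -
  have "(\<Sum>i=1..M. if s i = s j then f i else 0) = (\<Sum>i=1..M. if i = j then f i else 0)"
    using assms by (intro sum.cong) (auto dest: inj_onD)
  then show ?thesis using assms(2) by simp
qed

text \<open>The two families carry unrelated indices; sorting by position turns both potentials into
  sums over one set of centres, which can be subtracted.\<close>

lemma retarded_potential_by_location: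
  fixes x :: "'a::real_normed_vector"
  assumes "finite P" "s ` {1..M} \<subseteq> P"
  shows "retarded_potential c lam M a s x t
    = (\<Sum>p\<in>P. (\<Sum>j=1..M. if s j = p then a j * lam (t - norm (x - p) / c) else 0) / norm (x - p))"
proof -
  have "(\<Sum>p\<in>P. (\<Sum>j=1..M. if s j = p then a j * lam (t - norm (x - p) / c) else 0) / norm (x - p))
      = (\<Sum>j=1..M. \<Sum>p\<in>P. if s j = p then a j * lam (t - norm (x - p) / c) / norm (x - p) else 0)"
    unfolding sum_divide_distrib by (subst sum.swap) (auto intro!: sum.cong)
  also have "\<dots> = retarded_potential c lam M a s x t"
    unfolding retarded_potential_def
  proof (intro sum.cong refl)
    fix j assume "j \<in> {1..M}"
    then have "s j \<in> P" using assms(2) by blast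
    then show "(\<Sum>p\<in>P. if s j = p then a j * lam (t - norm (x - p) / c) / norm (x - p) else 0)
        = a j * lam (t - norm (x - s j) / c) / norm (x - s j)"
      by (simp only: sum.delta'[OF assms(1)] if_True)
  qed
  finally show ?thesis ..
qed

theorem theorem2p2:
  fixes c :: real
    and \<Omega> :: "(real^3) set"
    and M1 M2 :: nat
    and s1 s2 :: "nat \<Rightarrow> real^3"
    and a1 a2 :: "nat \<Rightarrow> real"
    and lam1 lam2 :: "real \<Rightarrow> real"
    and u1 u2 :: "real^3 \<Rightarrow> real \<Rightarrow> real"
  assumes "c > 0"
    and "bounded \<Omega>" "convex \<Omega>" "open \<Omega>"
    and "M1 > 0" "M2 > 0"
    and "\<And>j. j \<in> {1..M1} \<Longrightarrow> s1 j \<in> \<Omega>" "\<And>j. j \<in> {1..M2} \<Longrightarrow> s2 j \<in> \<Omega>"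
    and "inj_on s1 {1..M1}" "inj_on s2 {1..M2}"
    and "\<And>j. j \<in> {1..M1} \<Longrightarrow> a1 j > 0" "\<And>j. j \<in> {1..M2} \<Longrightarrow> a2 j > 0"
    and "continuous_on UNIV lam1" "continuous_on UNIV lam2"
    and "causal_wave_solution c (point_sources lam1 M1 a1 s1) (s1 ` {1..M1}) u1"
    and "causal_wave_solution c (point_sources lam2 M2 a2 s2) (s2 ` {1..M2}) u2"
    and "causal lam1" "causal lam2"
    and "\<exists>t. lam1 t \<noteq> 0" "\<exists>t. lam2 t \<noteq> 0"
    and "\<And>x t. x \<in> frontier \<Omega> \<Longrightarrow> u1 x t = u2 x t"
  shows "M1 = M2 \<and>
    (\<exists>\<pi>. \<pi> permutes {1..M1} \<and>
      (\<forall>j\<in>{1..M1}. s1 j = s2 (\<pi> j) \<and> (\<forall>t. a1 j * lam1 t = a2 (\<pi> j) * lam2 t)))"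
proof -
  define P where "P = s1 ` {1..M1} \<union> s2 ` {1..M2}"
  \<comment> \<open>The signal emitted at position \<open>p\<close>, which is 0 if the first family
    has no source there; equality of \<open>F1\<close> and \<open>F2\<close> on \<open>P\<close>
    encodes the whole conclusion.\<close>
  define F1 where "F1 p t = (\<Sum>j=1..M1. if s1 j = p then a1 j * lam1 t else 0)" for p t
  define F2 where "F2 p t = (\<Sum>j=1..M2. if s2 j = p then a2 j * lam2 t else 0)" for p t
  have P: "finite P" "P \<subseteq> \<Omega>" using assms(7,8) by (auto simp: P_def)
  have F: "F1 p t = F2 p t" if "p \<in> P" for p t
  proof -
    have "F1 p t - F2 p t = 0"
    proof (rule spherical_waves_eq_0[where \<mu> = "\<lambda>p t. F1 p t - F2 p t"])
      show "2 \<le> DIM(real^3)" by simp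
      show "causal (\<lambda>t. F1 p t - F2 p t)" for p
        using assms(17,18) by (simp add: causal_def F1_def F2_def cong: if_cong)
      fix x t assume x: "x \<in> frontier \<Omega>"
      then have "x \<notin> P"
        using P(2) \<open>open \<Omega>\<close> by (auto simp: frontier_def interior_open)
      then have "retarded_potential c lam1 M1 a1 s1 x t = retarded_potential c lam2 M2 a2 s2 x t"
        using x assms(21)
        by (intro retarded_potential_eq[OF assms(1,13,14,15,16)]) (auto simp: P_def)
      then show "(\<Sum>p\<in>P. (F1 p (t - norm (x - p) / c) - F2 p (t - norm (x - p) / c)) / norm (x - p)) = 0"
        unfolding F1_def F2_def diff_divide_distrib sum_subtractf
        using retarded_potential_by_location[OF P(1), of s1 M1 c lam1 a1 x t]
          retarded_potential_by_location[OF P(1), of s2 M2 c lam2 a2 x t]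
        by (simp add: P_def)
    qed (use assms P that in auto)
    then show ?thesis by simp
  qed
  have F1s: "F1 (s1 j) t = a1 j * lam1 t" if "j \<in> {1..M1}" for j t
    unfolding F1_def by (rule sum_if_eq_inj_on[OF assms(9) that])
  have F2s: "F2 (s2 j) t = a2 j * lam2 t" if "j \<in> {1..M2}" for j t
    unfolding F2_def by (rule sum_if_eq_inj_on[OF assms(10) that])
  have F1o: "F1 p t = 0" if "p \<notin> s1 ` {1..M1}" for p t
    unfolding F1_def using that by (intro sum.neutral) auto
  have F2o: "F2 p t = 0" if "p \<notin> s2 ` {1..M2}" for p t
    unfolding F2_def using that by (intro sum.neutral) auto
  \<comment> \<open>An unmatched source would emit the zero signal, against \<open>a1 j > 0\<close>
    and the nontriviality of \<open>lam1\<close>.\<close>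
  have "s1 j \<in> s2 ` {1..M2}" if j: "j \<in> {1..M1}" for j
  proof (rule ccontr)
    assume "s1 j \<notin> s2 ` {1..M2}"
    then have "a1 j * lam1 t = 0" for t
      using F[of "s1 j" t] F1s[OF j] F2o j by (simp add: P_def)
    then show False using assms(11)[OF j] assms(19) by auto
  qed
  moreover have "s2 j \<in> s1 ` {1..M1}" if j: "j \<in> {1..M2}" for j
  proof (rule ccontr)
    assume "s2 j \<notin> s1 ` {1..M1}"
    then have "a2 j * lam2 t = 0" for t
      using F[of "s2 j" t] F2s[OF j] F1o j by (simp add: P_def)
    then show False using assms(12)[OF j] assms(20) by auto
  qed
  ultimately have S: "s1 ` {1..M1} = s2 ` {1..M2}" by blast
  then have M: "M1 = M2"
    using card_image[OF assms(9)] card_image[OF assms(10)] by simp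
  \<comment> \<open>The identity outside the index range is what \<open>permutes\<close>
    demands.\<close>
  define \<pi> where "\<pi> j = (if j \<in> {1..M1} then inv_into {1..M2} s2 (s1 j) else j)" for j
  have s\<pi>: "\<pi> j \<in> {1..M2}" "s2 (\<pi> j) = s1 j" if "j \<in> {1..M1}" for j
  proof -
    have "s1 j \<in> s2 ` {1..M2}" using S that by blast
    then show "\<pi> j \<in> {1..M2}" "s2 (\<pi> j) = s1 j"
      using that unfolding \<pi>_def by (simp_all only: if_True inv_into_into f_inv_into_f)
  qed
  have inj: "inj_on \<pi> {1..M1}"
    using s\<pi>(2) assms(9) by (metis (no_types, lifting) inj_onD inj_onI)
  moreover have "\<pi> ` {1..M1} = {1..M1}"
    using s\<pi>(1) M by (intro endo_inj_surj inj) auto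
  ultimately have "\<pi> permutes {1..M1}"
    by (intro bij_imp_permutes) (auto simp: bij_betw_def \<pi>_def)
  moreover have "s1 j = s2 (\<pi> j) \<and> (\<forall>t. a1 j * lam1 t = a2 (\<pi> j) * lam2 t)"
    if j: "j \<in> {1..M1}" for j
    using F[of "s1 j"] F1s[OF j] F2s[OF s\<pi>(1)[OF j]] s\<pi>(2)[OF j] j by (simp add: P_def)
  ultimately show ?thesis using M by blast
qed

end
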